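(* Let $n\ge2$ and let $\mathbf p=(p_1,\dots,p_n)$ with $p_i>0$, $\sum_ip_i=1$, be generic. When the coefficients $Q_1(\theta),Q_2(\theta),\dots$ are expanded into products of single-bin functions of $\theta_1,\dots,\theta_n$, the first term involving all $n$ coordinates is the contribution of $\frac1{n!}c_1(\theta)^n$ to $Q_n(\theta)$, which carries the product $\prod_{i=1}^nB_2(\theta_i)$. The $\mu_H$-average of this product is nonzero: $$\mathbb E_{\mu_H}\Bigl[\prod_{i=1}^nB_2(\theta_i)\Bigr]=\frac{(-1)^{n+1}2^nB_{2n}}{(2n)!}=\frac{2\zeta(2n)}{(2\pi^2)^n},$$ whereas its average under independent uniform coordinates on $[0,1)$ is $0$. More generally, for integers $k_1,\dots,k_n\ge1$ with $K:=\sum_ik_i$, and with $\widehat B_k(m):=-k!/(2\pi \mathrm i m)^k$ ($m\in\mathbb Z\setminus\{0\}$, $\mathrm i=\sqrt{-1}$) the Fourier coefficients of the 1-periodic function $x\mapsto B_k(\{x\})$, $$\mathbb E_{\mu_H}\Bigl[\prod_{i=1}^nB_{k_i}(\theta_i)\Bigr]=\sum_{m\in\mathbb Z\setminus\{0\}}\ \prod_{i=1}^n\widehat B_{k_i}(m)=\begin{cases}\dfrac{2(-1)^{n-K/2}\bigl(\prod_{i}k_i!\bigr)\zeta(K)}{(2\pi)^K},&K\text{ even},\\[6pt]0,&K\text{ odd}.\end{cases}$$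
   Context: $\mathbf p$ is called generic if $\{v\in\mathbb Z^n: v\cdot\mathbf p\in\mathbb Z\}=\mathbb Z\cdot(1,\dots,1)$. With $\mathbb T=\mathbb R/\mathbb Z$ (represented by $[0,1)$), $H=\{\theta\in\mathbb T^n:\sum_i\theta_i\equiv0\ (\mathrm{mod}\ 1)\}$ and $\mu_H$ is its Haar probability measure; $\{x\}$ is the fractional part. $B_k(x)$ are Bernoulli polynomials, $B_k=B_k(0)$, and $\zeta$ is the Riemann zeta function. For $\theta\in[0,1)^n$, $$c_k(\theta)=\frac{(-1)^{k+1}}{k(k+1)}\Bigl[B_{k+1}-\sum_{i=1}^n p_i^{-k}B_{k+1}(1-\theta_i)\Bigr]\quad(k\ge1),$$ and $Q_j(\theta)$ is defined by $\exp\bigl(\sum_{k\ge1}c_k(\theta)x^k\bigr)=\sum_{j\ge0}Q_j(\theta)x^j$. Expansion into single-bin functions means expanding each product $c_{r_1}\cdots c_{r_\ell}$ occurring in $Q_j$ using that every $c_r(\theta)$ is a constant plus a sum over $i$ of functions of the single variable $\theta_i$. (For generic $\mathbf p$ the sequence $\theta(N)=(\{Np_1\},\dots,\{Np_n\})$ is equidistributed on $H$ by Weyl's theorem, so $\mu_H$-averages are Cesàro means over $N$.) *)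

theory Defs
  imports "HOL-Probability.Probability" "HOL-Computational_Algebra.Formal_Power_Series"
begin

text \<open>Vectors with \<open>n\<close> coordinates are functions on \<^typ>\<open>nat\<close> restricted to the index set
  \<open>{1..n}\<close>.\<close>

definition generic :: "nat \<Rightarrow> (nat \<Rightarrow> real) \<Rightarrow> bool" where
  "generic n p \<longleftrightarrow>
     {v \<in> {1..n} \<rightarrow>\<^sub>E (UNIV :: int set). (\<Sum>i=1..n. of_int (v i) * p i) \<in> \<int>}
       = range (\<lambda>m. \<lambda>i\<in>{1..n}. m)"

subsection \<open>Bernoulli polynomials and the zeta function\<close>

text \<open>\<open>t * exp (x * t) / (exp t - 1) = (\<Sum>k. bernpoly k x * t ^ k / fact k)\<close>\<close>

definition bernpoly :: "nat \<Rightarrow> real \<Rightarrow> real" where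
  "bernpoly k x = fact k * fps_nth (fps_X * fps_exp x / (fps_exp 1 - 1)) k"

definition bernoulli :: "nat \<Rightarrow> real" where
  "bernoulli k = bernpoly k 0"

text \<open>Meaningful for \<open>s > 1\<close> only, the region of convergence of the Dirichlet series.\<close>

definition zeta :: "real \<Rightarrow> real" where
  "zeta s = (\<Sum>m. 1 / real (Suc m) powr s)"

definition bernpoly_fourier :: "nat \<Rightarrow> int \<Rightarrow> complex" where
  "bernpoly_fourier k m = - fact k / (2 * of_real pi * \<i> * of_int m) ^ k"

subsection \<open>The subgroup $H$ of the torus and its Haar measure\<close>

definition torus :: "nat \<Rightarrow> (nat \<Rightarrow> real) set" where
  "torus n = {1..n} \<rightarrow>\<^sub>E {0..<1}"

definition torus_add :: "nat \<Rightarrow> (nat \<Rightarrow> real) \<Rightarrow> (nat \<Rightarrow> real) \<Rightarrow> (nat \<Rightarrow> real)" where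
  "torus_add n \<theta> \<phi> = (\<lambda>i\<in>{1..n}. frac (\<theta> i + \<phi> i))"

definition H :: "nat \<Rightarrow> (nat \<Rightarrow> real) set" where
  "H n = {\<theta> \<in> torus n. (\<Sum>i=1..n. \<theta> i) \<in> \<int>}"

text \<open>The bijection \<open>[0,1) \<rightarrow> \<real>/\<int>\<close> is a Borel isomorphism, so the Borel sets of \<open>H\<close> as a
  subspace of the torus are the traces on \<open>H\<close> of the Borel sets of the product of \<open>n\<close> real
  lines.\<close>

definition haar_prob_on_H :: "nat \<Rightarrow> (nat \<Rightarrow> real) measure \<Rightarrow> bool" where
  "haar_prob_on_H n M \<longleftrightarrow>
     prob_space M \<and>
     sets M = sets (restrict_space (Pi\<^sub>M {1..n} (\<lambda>_. borel)) (H n)) \<and>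
     (\<forall>\<phi>\<in>H n. \<forall>A\<in>sets M. emeasure M (torus_add n \<phi> ` A) = emeasure M A)"

definition \<mu>H :: "nat \<Rightarrow> (nat \<Rightarrow> real) measure" where
  "\<mu>H n = (THE M. haar_prob_on_H n M)"

definition uniform_cube :: "nat \<Rightarrow> (nat \<Rightarrow> real) measure" where
  "uniform_cube n = Pi\<^sub>M {1..n} (\<lambda>_. uniform_measure lborel {0..<1})"

subsection \<open>The coefficients and their expansion into single-bin functions\<close>

definition c :: "nat \<Rightarrow> (nat \<Rightarrow> real) \<Rightarrow> nat \<Rightarrow> (nat \<Rightarrow> real) \<Rightarrow> real" where
  "c n p k \<theta> = (-1) ^ (k + 1) / (real k * real (k + 1)) *
     (bernoulli (k + 1) - (\<Sum>i=1..n. inverse (p i) ^ k * bernpoly (k + 1) (1 - \<theta> i)))"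

definition Q :: "nat \<Rightarrow> (nat \<Rightarrow> real) \<Rightarrow> nat \<Rightarrow> (nat \<Rightarrow> real) \<Rightarrow> real" where
  "Q n p j \<theta> =
     fps_nth (fps_compose (fps_exp 1) (Abs_fps (\<lambda>k. if k = 0 then 0 else c n p k \<theta>))) j"

text \<open>The summands of \<open>c n p k\<close>: its constant (\<open>None\<close>) and its single-bin function of \<open>\<theta> i\<close>
  (\<open>Some i\<close>).\<close>

fun c_summand :: "(nat \<Rightarrow> real) \<Rightarrow> nat \<Rightarrow> nat option \<Rightarrow> (nat \<Rightarrow> real) \<Rightarrow> real" where
  "c_summand p k None \<theta> = (-1) ^ (k + 1) / (real k * real (k + 1)) * bernoulli (k + 1)"
| "c_summand p k (Some i) \<theta> =
     - ((-1) ^ (k + 1) / (real k * real (k + 1)) * inverse (p i) ^ k * bernpoly (k + 1) (1 - \<theta> i))"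

text \<open>\<open>Q n p j\<close> is the sum, over all tuples of positive integers \<open>r\<^sub>1, \<dots>, r\<^sub>l\<close> with sum \<open>j\<close>, of the
  products of \<open>c n p r\<^sub>1, \<dots>, c n p r\<^sub>l\<close> divided by \<open>fact l\<close>. Multiplying out such a product means
  choosing a summand \<open>b\<^sub>t\<close> of each factor; the list \<open>[(r\<^sub>1, b\<^sub>1), \<dots>, (r\<^sub>l, b\<^sub>l)]\<close> stands for the
  resulting term.\<close>

definition expansion :: "nat \<Rightarrow> nat \<Rightarrow> (nat \<times> nat option) list set" where
  "expansion n j = {ts. set ts \<subseteq> {1..} \<times> insert None (Some ` {1..n}) \<and> sum_list (map fst ts) = j}"

definition term_value ::
  "(nat \<Rightarrow> real) \<Rightarrow> (nat \<times> nat option) list \<Rightarrow> (nat \<Rightarrow> real) \<Rightarrow> real" where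
  "term_value p ts \<theta> = (\<Prod>(r, b)\<leftarrow>ts. c_summand p r b \<theta>) / fact (length ts)"

definition involves_all :: "nat \<Rightarrow> (nat \<times> nat option) list \<Rightarrow> bool" where
  "involves_all n ts \<longleftrightarrow> (\<forall>i\<in>{1..n}. Some i \<in> snd ` set ts)"

text \<open>The terms obtained by multiplying out \<open>c n p 1 \<theta> ^ n / fact n\<close>.\<close>

definition c1_power_terms :: "nat \<Rightarrow> (nat \<times> nat option) list set" where
  "c1_power_terms n = {ts \<in> expansion n n. map fst ts = replicate n 1}"

end

theory Submission
  imports Defs "HOL-Combinatorics.Multiset_Permutations"
begin

text \<open>On \<open>H\<close> the first \<open>n - 1\<close> coordinates are independent and uniform and the last one is
  \<open>- (\<theta>\<^sub>1 + \<dots> + \<theta>\<^sub>n\<^sub>-\<^sub>1)\<close> modulo \<open>1\<close>, so the average of \<open>\<Prod>i. B\<^bsub>k i\<^esub> (\<theta> i)\<close> is the value at \<open>0\<close> of an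
  iterated convolution of periodised Bernoulli polynomials. Integration by parts shows that
  \<open>B\<^sub>j * B\<^sub>k = - (j! k! / (j + k)!) B\<^bsub>j + k\<^esub>\<close>, also for \<open>j = 1\<close> or \<open>k = 1\<close>, where the Fourier series
  does not converge absolutely; the average is thus a multiple of the Bernoulli number \<open>B\<^sub>K\<close>, and
  Euler's formula expresses the latter by \<open>\<zeta>(K)\<close>. A term of \<open>Q\<^sub>j\<close> that involves all \<open>n\<close> coordinates
  has at least \<open>n\<close> factors, each of weight at least \<open>1\<close>; for \<open>j = n\<close> all the weights are \<open>1\<close> and the
  terms correspond to the orderings of the coordinates.\<close>

section \<open>Bernoulli numbers and zeta values\<close>

text \<open>The sum over m is not obtained by integrating Fourier series term by term. The average
  and the sum are evaluated separately and meet at zeta(K): the sum over nonzero integers converges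
  absolutely because K >= n >= 2 and is visibly a multiple of zeta(K), while the average is a
  multiple of B_K. Euler's formula is the hinge between them. Since Bernoulli numbers are defined
  here as coefficients of a quotient of formal power series, that formula is proved by comparing
  coefficients with an expansion derived from the product formula for the sine. The constant in the
  average has a simple origin: n - 1 convolutions contribute n - 1 minus signs, and in the factors
  j! k! / (j + k)! all intermediate factorials cancel, leaving the product of the k_i! over K!. A
  second obstacle is that \<open>\<mu>H n\<close> is a definite description. Nothing can be computed
  with it before an invariant probability measure is known both to exist and to be unique. Existence
  comes with an explicit push-forward, which is then the form used for integration.\<close>

lemma has_fps_expansion_unique:
  fixes f :: "complex \<Rightarrow> complex"
  assumes "f has_fps_expansion F" "f has_fps_expansion G"
  shows "F = G"
  using fps_nth_fps_expansion[OF assms(1)] fps_nth_fps_expansion[OF assms(2)]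
  by (simp add: fps_eq_iff)

lemma zeta_sums:
  assumes "k \<ge> 2"
  shows "(\<lambda>m. 1 / real (Suc m) ^ k) sums zeta (real k)"
proof -
  have "summable (\<lambda>m. inverse (real (Suc m) ^ k))"
    using inverse_power_summable[OF assms, where 'a = real] by (subst summable_Suc_iff)
  then show ?thesis
    by (simp add: zeta_def powr_realpow field_simps sums_iff)
qed

lemma zeta_pos:
  assumes "k \<ge> 2"
  shows "zeta (real k) > 0"
  using zeta_sums[OF assms] suminf_pos[of "\<lambda>m. 1 / real (Suc m) ^ k"]
  by (simp add: sums_iff del: of_nat_Suc)

text \<open>Each logarithm is expanded in powers of \<open>u\<close>, and the resulting double
  series is summed over \<open>k\<close> first. Absolute summability of the double family justifies
  the exchange; the column of exponent j collects zeta(2j).\<close>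

lemma sum_Ln_one_minus_sums:
  fixes u :: complex
  assumes "norm u < 1"
  obtains S where "(\<lambda>k. ln (1 - u / of_nat (Suc k) ^ 2)) sums S"
    "(\<lambda>j. - of_real (zeta (real (2 * j))) * u ^ j / of_nat j) sums S"
proof -
  \<comment> \<open>Division by zero yields 0, so \<open>t k 0 = 0\<close> and the logarithm series,
    which really starts at j = 1, may be summed from 0.\<close>
  define t :: "nat \<Rightarrow> nat \<Rightarrow> complex" where "t k j = - ((u / of_nat (Suc k) ^ 2) ^ j) / of_nat j" for k j
  have le: "norm (u / of_nat (Suc k) ^ 2) \<le> norm u / real (Suc k) ^ 2" for k
    by (simp add: norm_divide norm_power del: of_nat_Suc)
  have le1: "norm u / real (Suc k) ^ 2 < 1" for k
  proof -
    have "norm u / real (Suc k) ^ 2 \<le> norm u / 1"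
      by (intro divide_left_mono) auto
    then show ?thesis using assms by linarith
  qed
  have row: "t k sums ln (1 - u / of_nat (Suc k) ^ 2)" for k
    using Ln_series'[of "- (u / of_nat (Suc k) ^ 2)"] le[of k] le1[of k]
    by (simp add: t_def[abs_def] del: of_nat_Suc)
  \<comment> \<open>For j >= 1 the power (k + 1)^(2j) in the denominator is at least (k + 1)^2.
    Weakening it to that makes the majorant a product of a function of k and a geometric
    series.\<close>
  define b where "b = (\<lambda>(k, j). (1 / real (Suc k) ^ 2) * norm u ^ j)"
  have "b summable_on UNIV \<times> UNIV"
    unfolding b_def
  proof (rule summable_on_SigmaI[where g = "\<lambda>k. (1 / real (Suc k) ^ 2) * (1 / (1 - norm u))"])
    fix k :: nat
    have "((\<lambda>j. norm u ^ j) has_sum 1 / (1 - norm u)) UNIV"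
      using geometric_sums[of "norm u"] assms by (intro sums_nonneg_imp_has_sum) auto
    from has_sum_cmult_right[OF this, of "1 / real (Suc k) ^ 2"]
    show "((\<lambda>j. case (k, j) of (k, j) \<Rightarrow> 1 / real (Suc k) ^ 2 * norm u ^ j) has_sum
        1 / real (Suc k) ^ 2 * (1 / (1 - norm u))) UNIV"
      by simp
  next
    have "((\<lambda>k. 1 / real (Suc k) ^ 2) has_sum zeta (real 2)) UNIV"
      using zeta_sums[of 2] by (intro sums_nonneg_imp_has_sum) auto
    from has_sum_cmult_left[OF this, of "1 / (1 - norm u)"]
    show "(\<lambda>k. 1 / real (Suc k) ^ 2 * (1 / (1 - norm u))) summable_on UNIV"
      unfolding summable_on_def by blast
  qed auto
  then have b: "b summable_on UNIV"
    by simp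
  have "norm (case x of (k, j) \<Rightarrow> t k j) \<le> b x" for x
  proof (cases x)
    case (Pair k j)
    show ?thesis
    proof (cases "j = 0")
      case False
      have "norm (t k j) \<le> (norm u / real (Suc k) ^ 2) ^ j / 1"
        unfolding t_def norm_divide norm_minus_cancel norm_power
        using False le[of k] by (intro frac_le power_mono) (auto simp: norm_divide norm_power simp del: of_nat_Suc)
      also have "\<dots> = norm u ^ j / (real (Suc k) ^ 2) ^ j"
        by (simp add: power_divide)
      also have "\<dots> \<le> norm u ^ j / (real (Suc k) ^ 2) ^ 1"
        using False by (intro divide_left_mono power_increasing) auto
      finally show ?thesis
        by (simp add: Pair b_def)
    qed (simp add: Pair b_def t_def)
  qed
  then have "(\<lambda>x. norm (case x of (k, j) \<Rightarrow> t k j)) summable_on UNIV"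
    using b by (intro summable_on_comparison_test[OF b]) auto
  then have "(\<lambda>(k, j). t k j) summable_on UNIV"
    by (rule abs_summable_summable)
  then obtain S where S: "((\<lambda>(k, j). t k j) has_sum S) (UNIV \<times> UNIV)"
    unfolding summable_on_def by auto
  have rows: "((\<lambda>j. t k j) has_sum ln (1 - u / of_nat (Suc k) ^ 2)) UNIV" for k
  proof -
    have "t k summable_on UNIV"
      using S summable_on_SigmaD1[of t UNIV "\<lambda>_. UNIV" k] by (auto simp: summable_on_def)
    then show ?thesis
      using row[of k] has_sum_imp_sums[OF has_sum_infsum] has_sum_infsum sums_unique2 by metis
  qed
  have "((\<lambda>k. ln (1 - u / of_nat (Suc k) ^ 2)) has_sum S) UNIV"
    using has_sum_SigmaD[OF S, of "\<lambda>k. ln (1 - u / of_nat (Suc k) ^ 2)"] rows by simp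
  then have 1: "(\<lambda>k. ln (1 - u / of_nat (Suc k) ^ 2)) sums S"
    by (rule has_sum_imp_sums)
  have S': "((\<lambda>(j, k). t k j) has_sum S) (UNIV \<times> UNIV)"
    using S by (subst has_sum_swap) simp
  have col: "((\<lambda>k. t k j) has_sum (- of_real (zeta (real (2 * j))) * u ^ j / of_nat j)) UNIV" for j
  proof (cases "j = 0")
    case False
    have "((\<lambda>k. 1 / real (Suc k) ^ (2 * j)) has_sum zeta (real (2 * j))) UNIV"
      using zeta_sums[of "2 * j"] False by (intro sums_nonneg_imp_has_sum) auto
    then have "((\<lambda>k. of_real (1 / real (Suc k) ^ (2 * j))) has_sum
        (of_real (zeta (real (2 * j))) :: complex)) UNIV"
      by (rule has_sum_of_real)
    moreover have "t k j = of_real (1 / real (Suc k) ^ (2 * j)) * (- (u ^ j) / of_nat j)" for k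
      by (simp add: t_def power_divide power_mult del: of_nat_Suc)
    ultimately show ?thesis
      using has_sum_cmult_left[where c = "- (u ^ j) / of_nat j"] by fastforce
  qed (simp add: t_def)
  have "((\<lambda>j. - of_real (zeta (real (2 * j))) * u ^ j / of_nat j) has_sum S) UNIV"
    using has_sum_SigmaD[OF S', of "\<lambda>j. - of_real (zeta (real (2 * j))) * u ^ j / of_nat j"] col by simp
  then have 2: "(\<lambda>j. - of_real (zeta (real (2 * j))) * u ^ j / of_nat j) sums S"
    by (rule has_sum_imp_sums)
  from that[OF 1 2] show ?thesis .
qed

text \<open>Taylor series at 0 of log (sin (pi z) / (pi z)). The term - zeta(2i) z^(2i) / i is
  indexed here by j = 2i, which turns 1 / i into 2 / j.\<close>

definition log_sinc_fps :: "complex fps" where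
  "log_sinc_fps = Abs_fps (\<lambda>j. if even j \<and> j > 0 then - 2 * of_real (zeta (real j)) / of_nat j else 0)"

text \<open>Exponentiating the partial sums of logarithms gives the partial products of the sine
  product, so continuity of \<open>exp\<close> suffices and no branch of a logarithm of the sine has
  to be chosen.\<close>

lemma sin_eq_exp_log_sinc:
  fixes z :: complex
  assumes "norm z < 1"
  obtains S where "(\<lambda>j. fps_nth log_sinc_fps j * z ^ j) sums S" "sin (of_real pi * z) = of_real pi * z * exp S"
proof -
  have u: "norm (z ^ 2) < 1"
    using assms by (simp add: norm_power power_less_one_iff)
  obtain S where S1: "(\<lambda>k. ln (1 - z ^ 2 / of_nat (Suc k) ^ 2)) sums S"
    and S2: "(\<lambda>j. - of_real (zeta (real (2 * j))) * (z ^ 2) ^ j / of_nat j) sums S"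
    using sum_Ln_one_minus_sums[OF u] .
  have "(\<lambda>j. fps_nth log_sinc_fps (2 * j) * z ^ (2 * j)) sums S"
    using S2 by (rule sums_cong[THEN iffD1, rotated]) (auto simp: log_sinc_fps_def power_mult)
  then have A: "(\<lambda>j. fps_nth log_sinc_fps j * z ^ j) sums S"
    by (subst (asm) sums_mono_reindex[of "\<lambda>j. 2 * j"])
       (auto simp: strict_mono_def log_sinc_fps_def image_iff elim!: evenE)
  \<comment> \<open>\<open>exp (ln w) = w\<close> requires every factor of the product to be
    nonzero.\<close>
  have nz: "1 - z ^ 2 / of_nat (Suc k) ^ 2 \<noteq> 0" for k
  proof
    assume "1 - z ^ 2 / of_nat (Suc k) ^ 2 = 0"
    then have "z ^ 2 = of_nat (Suc k) ^ 2"
      by (simp del: of_nat_Suc)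
    then have "norm (z ^ 2) = real (Suc k) ^ 2"
      by (simp add: norm_power del: of_nat_Suc)
    moreover have "real (Suc k) ^ 2 \<ge> 1"
      by simp
    ultimately show False using u by linarith
  qed
  have "(\<lambda>n. exp (\<Sum>k<n. ln (1 - z ^ 2 / of_nat (Suc k) ^ 2))) \<longlonglongrightarrow> exp S"
    using S1 unfolding sums_def by (rule tendsto_exp)
  moreover have "exp (\<Sum>k<n. ln (1 - z ^ 2 / of_nat (Suc k) ^ 2)) = (\<Prod>k=1..n. 1 - z ^ 2 / of_nat k ^ 2)" for n
  proof -
    have "exp (\<Sum>k<n. ln (1 - z ^ 2 / of_nat (Suc k) ^ 2)) = (\<Prod>k<n. 1 - z ^ 2 / of_nat (Suc k) ^ 2)"
      using nz by (simp add: exp_sum del: of_nat_Suc)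
    also have "\<dots> = (\<Prod>k=1..n. 1 - z ^ 2 / of_nat k ^ 2)"
      by (rule prod.reindex_bij_witness[of _ "\<lambda>k. k - 1" Suc]) auto
    finally show ?thesis .
  qed
  ultimately have "(\<lambda>n. of_real pi * z * (\<Prod>k=1..n. 1 - z ^ 2 / of_nat k ^ 2)) \<longlonglongrightarrow> of_real pi * z * exp S"
    by (intro tendsto_intros) simp
  then have "sin (of_real pi * z) = of_real pi * z * exp S"
    using sin_product_formula_complex LIMSEQ_unique by blast
  with A that show ?thesis by blast
qed

text \<open>The Taylor series of \<open>\<pi> z cot (\<pi> z)\<close>, obtained from the logarithmic derivative of the product
  formula for the sine.\<close>

definition cot_fps :: "complex fps" where
  "cot_fps = Abs_fps (\<lambda>j. if j = 0 then 1 else if even j then - 2 * of_real (zeta (real j)) else 0)"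

text \<open>The identity is kept free of quotients because the sine series has constant term 0 and
  is not invertible. It follows by differentiating sin (pi z) = pi z exp (L z) near 0 and using that
  a power series expansion is unique.\<close>

lemma cot_fps_times_sin: "cot_fps * fps_sin (of_real pi) = fps_const (of_real pi) * fps_X * fps_cos (of_real pi)"
proof -
  define L where "L = eval_fps log_sinc_fps"
  have 1: "eventually (\<lambda>z::complex. z \<in> ball 0 1) (nhds 0)"
    by (intro eventually_nhds_in_open) auto
  have "L has_fps_expansion log_sinc_fps"
  proof (rule has_fps_expansionI)
    show "eventually (\<lambda>z. (\<lambda>j. fps_nth log_sinc_fps j * z ^ j) sums L z) (nhds 0)"
      using 1
    proof eventually_elim
      case (elim z)
      then show ?case
        using sin_eq_exp_log_sinc[of z] unfolding L_def eval_fps_def by (auto simp: sums_iff)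
    qed
  qed
  note Le = this
  have sinL: "sin (of_real pi * z) = of_real pi * z * exp (L z)" if "z \<in> ball 0 1" for z
    using sin_eq_exp_log_sinc[of z] that unfolding L_def eval_fps_def by (auto simp: sums_iff)
  have cr: "fps_conv_radius log_sinc_fps > 0"
    using Le unfolding has_fps_expansion_def by blast
  have "eventually (\<lambda>z. z \<in> ball 0 1 \<inter> eball 0 (fps_conv_radius log_sinc_fps)) (nhds 0)"
    using cr by (intro eventually_nhds_in_open open_Int) (auto simp: zero_ereal_def)
  then have ev: "eventually (\<lambda>z. (1 + z * deriv L z) * sin (of_real pi * z) = of_real pi * z * cos (of_real pi * z)) (nhds 0)"
  proof eventually_elim
    case (elim z)
    have dL: "(L has_field_derivative deriv L z) (at z)"
      using elim unfolding L_def
      by (intro DERIV_deriv_iff_field_differentiable[THEN iffD2] holomorphic_on_imp_differentiable_at[OF holomorphic_on_eval_fps]) auto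
    have "((\<lambda>z. of_real pi * z * exp (L z)) has_field_derivative
             of_real pi * exp (L z) + of_real pi * z * (exp (L z) * deriv L z)) (at z)"
      by (rule derivative_eq_intros dL refl | simp)+
    moreover have "((\<lambda>z. sin (of_real pi * z)) has_field_derivative cos (of_real pi * z) * of_real pi) (at z)"
      by (rule derivative_eq_intros refl | simp)+
    then have "((\<lambda>z. of_real pi * z * exp (L z)) has_field_derivative cos (of_real pi * z) * of_real pi) (at z)"
      by (rule has_field_derivative_transform_within_open[of _ _ _ "ball 0 1"]) (use elim sinL in auto)
    ultimately have "of_real pi * exp (L z) + of_real pi * z * (exp (L z) * deriv L z) = cos (of_real pi * z) * of_real pi"
      by (rule DERIV_unique)
    \<comment> \<open>Multiplication by \<open>z\<close> recreates the factor pi z exp (L z), which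
      is the sine again, so that no division by \<open>z\<close> at 0 occurs.\<close>
    then have "of_real pi * z * cos (of_real pi * z) = z * (of_real pi * exp (L z) + of_real pi * z * (exp (L z) * deriv L z))"
      by simp
    also have "\<dots> = (1 + z * deriv L z) * (of_real pi * z * exp (L z))"
      by (simp add: algebra_simps)
    finally show ?case
      using sinL[of z] elim by (metis IntD1)
  qed
  have "(\<lambda>z. (1 + z * deriv L z) * sin (of_real pi * z)) has_fps_expansion
          ((1 + fps_X * fps_deriv log_sinc_fps) * fps_sin (of_real pi))"
    by (intro fps_expansion_intros Le)
  moreover have "(\<lambda>z::complex. of_real pi * z * cos (of_real pi * z)) has_fps_expansion
          (fps_const (of_real pi) * fps_X * fps_cos (of_real pi))"
    by (intro fps_expansion_intros)
  then have "(\<lambda>z. (1 + z * deriv L z) * sin (of_real pi * z)) has_fps_expansion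
          (fps_const (of_real pi) * fps_X * fps_cos (of_real pi))"
    unfolding has_fps_expansion_def using ev by (auto elim: eventually_elim2)
  ultimately have "(1 + fps_X * fps_deriv log_sinc_fps) * fps_sin (of_real pi) =
      fps_const (of_real pi) * fps_X * fps_cos (of_real pi)"
    by (rule has_fps_expansion_unique)
  moreover have "1 + fps_X * fps_deriv log_sinc_fps = cot_fps"
    by (rule fps_ext) (auto simp: cot_fps_def log_sinc_fps_def)
  ultimately show ?thesis by simp
qed

text \<open>A quotient of formal power series may be multiplied back only if the divisor divides.
  Here it has subdegree 1 and the dividend has subdegree at least 1. Most later identities for
  Bernoulli polynomials start from this product form.\<close>

lemma bernpoly_fps_eq: "Abs_fps (\<lambda>k. bernpoly k x / fact k) * (fps_exp 1 - 1) = fps_X * fps_exp x"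
proof -
  have "fps_exp 1 - 1 \<noteq> (0 :: real fps)"
    by simp
  moreover have "subdegree (fps_exp 1 - 1 :: real fps) = 1"
    by (rule subdegreeI) auto
  moreover have "subdegree (fps_X * fps_exp x) \<ge> 1"
    by (subst subdegree_mult) auto
  ultimately have "(fps_exp 1 - 1) dvd fps_X * fps_exp x"
    by (subst fps_dvd_iff) auto
  moreover have "Abs_fps (\<lambda>k. bernpoly k x / fact k) = fps_X * fps_exp x / (fps_exp 1 - 1)"
    by (simp add: bernpoly_def fps_eq_iff)
  ultimately show ?thesis
    by (simp add: dvd_div_mult_self)
qed

lemma fps_exp_minus_one_cancel:
  fixes F G :: "'a :: field_char_0 fps"
  assumes "F * (fps_exp 1 - 1) = G * (fps_exp 1 - 1)"
  shows "F = G"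
proof -
  have "fps_exp 1 - 1 \<noteq> (0 :: 'a fps)"
    by simp
  then show ?thesis using assms by simp
qed

text \<open>Coefficients of x / (exp x - 1) and of the transformed cotangent series agree except for
  the summand x / 2, which only affects degree 1. The factor (-1)^(k div 2) is the value of i^k for
  even k.\<close>

lemma bernoulli_eq_zeta:
  assumes "k \<ge> 2"
  shows "bernoulli k = (if even k then - 2 * (-1) ^ (k div 2) * fact k * zeta (real k) / (2 * pi) ^ k else 0)"
proof -
  define B :: "complex fps" where "B = Abs_fps (\<lambda>k. of_real (bernoulli k / fact k))"
  have "fps_nth (B * (fps_exp 1 - 1)) m = fps_nth fps_X m" for m
  proof -
    have "fps_nth (B * (fps_exp 1 - 1)) m =
        of_real (fps_nth (Abs_fps (\<lambda>k. bernoulli k / fact k) * (fps_exp 1 - 1)) m)"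
      unfolding fps_mult_nth B_def of_real_sum by (intro sum.cong) auto
    also have "\<dots> = fps_nth fps_X m"
      using bernpoly_fps_eq[of 0] by (simp add: bernoulli_def fps_X_def)
    finally show ?thesis .
  qed
  then have B: "B * (fps_exp 1 - 1) = fps_X"
    by (rule fps_ext)
  \<comment> \<open>\<open>z = \<i> x / (2 \<pi>)\<close> turns \<open>\<pi> z cot (\<pi> z)\<close> into \<open>x / (exp x - 1) + x / 2\<close>\<close>
  define w :: complex where "w = \<i> / (2 * of_real pi)"
  define G where "G = cot_fps oo (fps_const w * fps_X)"
  have G_nth: "fps_nth G j = w ^ j * fps_nth cot_fps j" for j
    unfolding G_def by (simp add: fps_compose_linear)
  define S C :: "complex fps" where "S = fps_sin (\<i> / 2)" and "C = fps_cos (\<i> / 2)"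
  have pw: "of_real pi * w = \<i> / 2"
    by (simp add: w_def)
  have S: "fps_sin (of_real pi) oo (fps_const w * fps_X) = S"
    by (simp add: S_def fps_compose_linear fps_eq_iff fps_sin_def flip: pw)
       (simp add: power_mult_distrib mult_ac)
  have C: "fps_cos (of_real pi) oo (fps_const w * fps_X) = C"
    by (simp add: C_def fps_compose_linear fps_eq_iff fps_cos_def flip: pw)
       (simp add: power_mult_distrib mult_ac)
  have "(cot_fps * fps_sin (of_real pi)) oo (fps_const w * fps_X) =
        (fps_const (of_real pi) * fps_X * fps_cos (of_real pi)) oo (fps_const w * fps_X)"
    by (simp only: cot_fps_times_sin)
  then have "G * S = fps_const (of_real pi) * (fps_const w * fps_X) * C"
    by (simp add: fps_compose_mult_distrib S C G_def)
  also have "\<dots> = fps_const (\<i> / 2) * fps_X * C"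
    by (simp flip: pw fps_const_mult)
  finally have GS: "G * S = fps_const (\<i> / 2) * fps_X * C" .
  \<comment> \<open>Since i * (i / 2) = - 1 / 2, sine and cosine at imaginary argument become
    combinations of exp (x / 2) and exp (- x / 2).\<close>
  have e1: "fps_exp (- (1/2)) = C + fps_const \<i> * S"
    using fps_exp_ii_sin_cos[of "\<i> / 2"] by (simp add: S_def C_def)
  have e2: "fps_exp (1/2) = C - fps_const \<i> * S"
    using fps_exp_minus_ii_sin_cos[of "\<i> / 2"] by (simp add: S_def C_def)
  have e3: "fps_exp (1/2) * fps_exp (- (1/2)) = (1 :: complex fps)" "fps_exp (1/2) * fps_exp (1/2) = (fps_exp 1 :: complex fps)"
    by (simp_all flip: fps_exp_add_mult)
  have half: "fps_const (1/2) * 2 = (1 :: complex fps)"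
    by (simp add: numeral_fps_const)
  have ii: "fps_const \<i> * fps_const (\<i> / 2) = - fps_const (1 / 2)"
    by (simp add: fps_eq_iff)
  have "G * (fps_exp (1/2) - fps_exp (- (1/2))) = - 2 * fps_const \<i> * (G * S)"
    by (simp add: e1 e2 algebra_simps)
  also have "\<dots> = - 2 * (fps_const \<i> * fps_const (\<i> / 2)) * fps_X * C"
    unfolding GS by (simp only: mult_ac)
  also have "\<dots> = (fps_const (1/2) * 2) * fps_X * C"
    unfolding ii fps_const_neg[symmetric] by (simp only: mult_minus_left mult_minus_right minus_minus mult_ac)
  also have "\<dots> = fps_const (1/2) * fps_X * (fps_exp (1/2) + fps_exp (- (1/2)))"
    by (simp add: e1 e2 algebra_simps)
  \<comment> \<open>The equation so far is G = (x / 2) coth (x / 2), cleared of denominators. The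
    factor \<open>fps_exp (1/2)\<close> turns the symmetric difference of exponentials into
    \<open>fps_exp 1 - 1\<close>.\<close>
  finally have "fps_exp (1/2) * (G * (fps_exp (1/2) - fps_exp (- (1/2)))) =
      fps_exp (1/2) * (fps_const (1/2) * fps_X * (fps_exp (1/2) + fps_exp (- (1/2))))"
    by simp
  then have "G * (fps_exp (1/2) * fps_exp (1/2) - fps_exp (1/2) * fps_exp (- (1/2))) =
      fps_const (1/2) * fps_X * (fps_exp (1/2) * fps_exp (1/2) + fps_exp (1/2) * fps_exp (- (1/2)))"
    by (simp add: algebra_simps)
  then have G: "G * (fps_exp 1 - 1) = fps_const (1/2) * fps_X * (fps_exp 1 + 1)"
    unfolding e3 .
  \<comment> \<open>Subtracting x / 2 leaves (x / 2) (exp x + 1) - (x / 2) (exp x - 1) = x on the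
    right.\<close>
  have "(G - fps_const (1/2) * fps_X) * (fps_exp 1 - 1) = (fps_const (1/2) * 2) * fps_X"
    by (simp only: left_diff_distrib G) (simp add: algebra_simps)
  also have "\<dots> = B * (fps_exp 1 - 1)"
    using half B by simp
  finally have "G - fps_const (1/2) * fps_X = B"
    by (rule fps_exp_minus_one_cancel)
  then have "fps_nth B k = fps_nth (G - fps_const (1/2) * fps_X) k"
    by simp
  also have "\<dots> = fps_nth G k"
    using assms by (cases k) (auto simp: fps_X_def fps_mult_left_const_nth)
  finally have "fps_nth B k = fps_nth G k" .
  then have "of_real (bernoulli k / fact k) = w ^ k * fps_nth cot_fps k"
    by (simp add: B_def G_nth)
  also have "\<dots> = of_real (if even k then - 2 * (-1) ^ (k div 2) * zeta (real k) / (2 * pi) ^ k else 0)"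
    using assms by (auto simp: cot_fps_def w_def power_divide power_mult_distrib elim!: evenE)
  finally have "bernoulli k / fact k = (if even k then - 2 * (-1) ^ (k div 2) * zeta (real k) / (2 * pi) ^ k else 0)"
    unfolding of_real_eq_iff .
  then show ?thesis
    by (auto simp: field_simps)
qed

section \<open>Bernoulli polynomials\<close>

text \<open>The generating function factors as its value at x = 0 times exp (x t). The Cauchy
  product exhibits \<open>bernpoly k\<close> as a polynomial, from which continuity and the
  derivative are read off.\<close>

lemma bernpoly_altdef:
  "bernpoly k x = fact k * (\<Sum>i=0..k. bernoulli i / fact i * (x ^ (k - i) / fact (k - i)))"
proof -
  have "(Abs_fps (\<lambda>k. bernoulli k / fact k) * fps_exp x) * (fps_exp 1 - 1) = fps_X * fps_exp x"
    using bernpoly_fps_eq[of 0] by (simp add: bernoulli_def mult_ac)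
  also have "\<dots> = Abs_fps (\<lambda>k. bernpoly k x / fact k) * (fps_exp 1 - 1)"
    by (simp add: bernpoly_fps_eq)
  finally have "Abs_fps (\<lambda>k. bernoulli k / fact k) * fps_exp x = Abs_fps (\<lambda>k. bernpoly k x / fact k)"
    by (rule fps_exp_minus_one_cancel)
  from arg_cong[OF this, of "\<lambda>f. fps_nth f k"] 
  have "bernpoly k x / fact k = (\<Sum>i=0..k. bernoulli i / fact i * (x ^ (k - i) / fact (k - i)))"
    by (simp add: fps_mult_nth)
  then show ?thesis
    by (simp add: field_simps)
qed

lemma bernpoly_0 [simp]: "bernpoly 0 x = 1"
  using arg_cong[OF bernpoly_fps_eq[of x], of "\<lambda>f. fps_nth f 1"] by (simp add: fps_mult_nth)

text \<open>The explicit form makes the symmetry B_2(1 - x) = B_2(x) available, which converts the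
  arguments \<open>1 - \<theta> i\<close> in \<open>c\<close> to \<open>\<theta> i\<close>.\<close>

lemma bernpoly_2: "bernpoly 2 x = x ^ 2 - x + 1 / 6"
proof -
  \<comment> \<open>The coefficient of degree m determines \<open>bernoulli (m - 1)\<close>, so
    degrees 2 and 3 yield the values at 1 and 2.\<close>
  have eq: "(\<Sum>i=0..m. bernoulli i / fact i * ((if m - i = 0 then 0 else 1 / fact (m - i)))) = (if m = 1 then 1 else 0)" for m
    using arg_cong[OF bernpoly_fps_eq[of 0], of "\<lambda>f. fps_nth f m"]
    by (auto simp: fps_mult_nth bernoulli_def fps_X_def intro!: sum.cong elim!: trans[rotated])
  have b0: "bernoulli 0 = 1"
    by (simp add: bernoulli_def)
  have b1: "bernoulli 1 = - 1 / 2"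
    using eq[of 2] b0 by (simp add: numeral_eq_Suc)
  have b2: "bernoulli 2 = 1 / 6"
    using eq[of 3] b0 b1 by (simp add: numeral_eq_Suc)
  show ?thesis
    unfolding bernpoly_altdef using b0 b1 b2 by (simp add: numeral_eq_Suc field_simps)
qed

text \<open>The generating functions at 1 and 0 differ by t (exp t - 1) / (exp t - 1) = t. Hence
  only the periodised B_1 jumps at the integers, and this jump is the source of every surviving
  boundary term below.\<close>

lemma bernpoly_1_right: "bernpoly k 1 = bernpoly k 0 + (if k = 1 then 1 else 0)"
proof -
  have "(Abs_fps (\<lambda>k. bernpoly k 1 / fact k) - Abs_fps (\<lambda>k. bernpoly k 0 / fact k)) * (fps_exp 1 - 1)
      = fps_X * (fps_exp 1 - 1)"
    by (simp only: left_diff_distrib bernpoly_fps_eq) (simp add: algebra_simps)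
  then have "Abs_fps (\<lambda>k. bernpoly k 1 / fact k) - Abs_fps (\<lambda>k. bernpoly k 0 / fact k) = fps_X"
    by (rule fps_exp_minus_one_cancel)
  from arg_cong[OF this, of "\<lambda>f. fps_nth f k"] show ?thesis
    by (auto simp: fps_X_def field_simps)
qed

lemma has_real_derivative_bernpoly:
  "(bernpoly (Suc k) has_real_derivative real (Suc k) * bernpoly k x) (at x)"
proof -
  have d: "((\<lambda>x. x ^ m / fact m) has_real_derivative real m * x ^ (m - 1) / fact m) (at x)" for m
    by (auto intro!: derivative_eq_intros)
  have "((\<lambda>x. fact (Suc k) * (\<Sum>i=0..Suc k. bernoulli i / fact i * (x ^ (Suc k - i) / fact (Suc k - i))))
      has_real_derivative fact (Suc k) * (\<Sum>i=0..Suc k. bernoulli i / fact i *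
         (real (Suc k - i) * x ^ (Suc k - i - 1) / fact (Suc k - i)))) (at x)"
    by (intro DERIV_cmult DERIV_sum d)
  also have "(\<Sum>i=0..Suc k. bernoulli i / fact i * (real (Suc k - i) * x ^ (Suc k - i - 1) / fact (Suc k - i)))
      = (\<Sum>i=0..k. bernoulli i / fact i * (x ^ (k - i) / fact (k - i)))"
    unfolding sum.atLeast0_atMost_Suc by (auto simp: Suc_diff_le simp del: of_nat_Suc intro!: sum.cong)
  also have "fact (Suc k) * \<dots> = real (Suc k) * bernpoly k x"
    by (simp add: bernpoly_altdef)
  finally show ?thesis
    by (simp add: bernpoly_altdef[abs_def])
qed

lemma continuous_on_bernpoly [continuous_intros]:
  "continuous_on A f \<Longrightarrow> continuous_on A (\<lambda>x. bernpoly k (f x))"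
  unfolding bernpoly_altdef by (intro continuous_intros) auto

lemma bernpoly_measurable [measurable]: "bernpoly k \<in> borel_measurable borel"
  by (intro borel_measurable_continuous_onI continuous_intros)

lemma frac_measurable [measurable]: "(frac :: real \<Rightarrow> real) \<in> borel_measurable borel"
  unfolding frac_def by measurable

lemma bernpoly_frac_bounded: "\<exists>C. \<forall>k x. \<bar>bernpoly k (frac x)\<bar> \<le> C k"
proof (intro choice allI)
  fix k
  have "compact (bernpoly k ` {0..1})"
    by (intro compact_continuous_image continuous_intros) auto
  then obtain C where C: "\<forall>x\<in>{0..1}. \<bar>bernpoly k x\<bar> \<le> C"
    by (auto dest!: compact_imp_bounded simp: bounded_real)
  have "\<bar>bernpoly k (frac x)\<bar> \<le> C" for x
    by (intro C[rule_format]) (simp add: frac_lt_1 less_imp_le)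
  then show "\<exists>C. \<forall>x. \<bar>bernpoly k (frac x)\<bar> \<le> C"
    by blast
qed

text \<open>Integration by parts gives a recursion in k with factor (k + 1) / a, where a = 2 pi i m.
  It is started by the jump of B_1, because the coefficient of B_0 = 1 vanishes for m
  nonzero.\<close>

lemma bernpoly_fourier_integral:
  assumes "m \<noteq> 0"
  shows "((\<lambda>x. of_real (bernpoly k x) * exp (- (2 * of_real pi * \<i> * of_int m * of_real x)))
           has_integral (if k = 0 then 0 else bernpoly_fourier k m)) {0..1}"
proof -
  define a :: complex where "a = 2 * of_real pi * \<i> * of_int m"
  have a: "a \<noteq> 0"
    using assms by (simp add: a_def)
  define e where "e x = exp (- (a * of_real x))" for x
  have e0: "e 0 = 1"
    by (simp add: e_def)
  have e1: "e 1 = 1"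
    unfolding e_def a_def using exp_integer_2pi[of "of_int (- m)"] by (simp add: mult_ac)
  have de: "(e has_vector_derivative - a * e x) (at x within S)" for x S
  proof -
    have "((\<lambda>z. exp (- (a * z))) has_field_derivative - a * e x) (at (of_real x))"
      unfolding e_def by (auto intro!: derivative_eq_intros)
    then show ?thesis
      unfolding e_def[abs_def] by (rule has_vector_derivative_real_field)
  qed
  have dB: "((\<lambda>x. of_real (bernpoly (Suc k) x)) has_vector_derivative of_nat (Suc k) * of_real (bernpoly k x))
      (at x within S)" for x S k
    using has_vector_derivative_of_real[OF has_real_derivative_bernpoly[of k x, THEN has_field_derivative_at_within[of _ _ _ S]]]
    by simp
  have "((\<lambda>x. of_real (bernpoly k x) * e x) has_integral (if k = 0 then 0 else - fact k / a ^ k)) {0..1}"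
  proof (induction k)
    case 0
    have "((\<lambda>x. - a * e x) has_integral (e 1 - e 0)) {0..1}"
      by (intro fundamental_theorem_of_calculus de) auto
    then have "((\<lambda>x. (- 1 / a) * (- a * e x)) has_integral (- 1 / a) * (e 1 - e 0)) {0..1}"
      by (rule has_integral_mult_right)
    then show ?case
      using a by (simp add: e0 e1)
  next
    case (Suc k)
    have "((\<lambda>x. of_real (bernpoly (Suc k) x) * (- a * e x) + of_nat (Suc k) * of_real (bernpoly k x) * e x) has_integral
        (of_real (bernpoly (Suc k) 1) * e 1 - of_real (bernpoly (Suc k) 0) * e 0)) {0..1}"
      by (intro fundamental_theorem_of_calculus has_vector_derivative_mult de dB) auto
    from has_integral_diff[OF this has_integral_mult_right[OF Suc.IH, of "of_nat (Suc k)"]]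
    have "((\<lambda>x. - a * (of_real (bernpoly (Suc k) x) * e x)) has_integral
        ((if k = 0 then 1 else 0) - of_nat (Suc k) * (if k = 0 then 0 else - fact k / a ^ k))) {0..1}"
      by (cases "k = 0") (simp_all add: e0 e1 bernpoly_1_right algebra_simps)
    from has_integral_mult_right[OF this, of "- 1 / a"]
    show ?case
      using a by (auto simp: field_simps split: if_splits)
  qed
  then show ?thesis
    unfolding e_def unfolding a_def bernpoly_fourier_def .
qed

lemma bernpoly_fourier_integral_frac:
  assumes "k \<ge> 1" "m \<noteq> 0"
  shows "((\<lambda>x. of_real (bernpoly k (frac x)) * exp (- (2 * of_real pi * \<i> * of_int m * of_real x)))
           has_integral bernpoly_fourier k m) {0..1}"
\<comment> \<open>At x = 1 \<open>frac\<close> falls back to 0, which alters the integrand when k =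
  1; one point does not affect the integral.\<close>
proof (rule has_integral_spike_finite[of "{1}" "{0..1}"])
  show "((\<lambda>x. of_real (bernpoly k x) * exp (- (2 * of_real pi * \<i> * of_int m * of_real x)))
           has_integral bernpoly_fourier k m) {0..1}"
    using bernpoly_fourier_integral[OF assms(2), of k] assms(1) by simp
  fix x :: real
  assume "x \<in> {0..1} - {1}"
  then have "frac x = x"
    by (simp add: frac_eq)
  then show "of_real (bernpoly k (frac x)) * exp (- (2 * of_real pi * \<i> * of_int m * of_real x)) =
      of_real (bernpoly k x) * exp (- (2 * of_real pi * \<i> * of_int m * of_real x))"
    by simp
qed simp

section \<open>Convolution of periodised Bernoulli polynomials\<close>

lemma bernpoly_by_parts:
  fixes a b s :: real
  assumes "a \<le> b"
  shows "real (Suc k) * integral {a..b} (\<lambda>x. bernpoly j x * bernpoly k (s - x)) =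
     real j * integral {a..b} (\<lambda>x. bernpoly (j - 1) x * bernpoly (Suc k) (s - x))
     - (bernpoly j b * bernpoly (Suc k) (s - b) - bernpoly j a * bernpoly (Suc k) (s - a))"
proof -
  have dk: "((\<lambda>x. bernpoly (Suc k) (s - x)) has_real_derivative - (real (Suc k) * bernpoly k (s - x))) (at x within S)" for x S
    using DERIV_chain'[OF DERIV_diff[OF DERIV_const DERIV_ident] has_real_derivative_bernpoly[of k "s - x"], of UNIV]
    by (auto intro: has_field_derivative_at_within)
  \<comment> \<open>For j = 0 the truncated \<open>j - 1\<close> is 0 again, and the factor
    \<open>real j\<close> makes the term vanish as it should.\<close>
  have dj: "(bernpoly j has_real_derivative real j * bernpoly (j - 1) x) (at x within S)" for x S
  proof (cases j)
    case (Suc j')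
    then show ?thesis
      using has_real_derivative_bernpoly[of j' x] by (auto intro: has_field_derivative_at_within)
  qed (simp add: bernpoly_0[abs_def])
  have int: "(\<lambda>x. bernpoly i x * bernpoly l (s - x)) integrable_on {a..b}" for i l
    by (intro integrable_continuous_real continuous_intros)
  define F where "F = (\<lambda>x. real j * (bernpoly (j - 1) x * bernpoly (Suc k) (s - x)) - real (Suc k) * (bernpoly j x * bernpoly k (s - x)))"
  have "((\<lambda>x. bernpoly j x * bernpoly (Suc k) (s - x)) has_vector_derivative
      real j * bernpoly (j - 1) x * bernpoly (Suc k) (s - x) + - (real (Suc k) * bernpoly k (s - x)) * bernpoly j x)
      (at x within {a..b})" for x
    unfolding has_real_derivative_iff_has_vector_derivative[symmetric] by (rule DERIV_mult dk dj)+
  moreover have "real j * bernpoly (j - 1) x * bernpoly (Suc k) (s - x) + - (real (Suc k) * bernpoly k (s - x)) * bernpoly j x = F x" for x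
    by (simp add: F_def)
  ultimately have 1: "(F has_integral (bernpoly j b * bernpoly (Suc k) (s - b) - bernpoly j a * bernpoly (Suc k) (s - a))) {a..b}"
    using assms
    by (intro fundamental_theorem_of_calculus) auto
  have 2: "(F has_integral (real j * integral {a..b} (\<lambda>x. bernpoly (j - 1) x * bernpoly (Suc k) (s - x)) -
       real (Suc k) * integral {a..b} (\<lambda>x. bernpoly j x * bernpoly k (s - x)))) {a..b}"
    unfolding F_def by (intro has_integral_diff has_integral_mult_right integrable_integral int)
  show ?thesis
    using has_integral_unique[OF 1 2] by linarith
qed

text \<open>The circle is cut at x = y, where the argument of the second factor wraps around. Each
  integration by parts moves one degree from j to k. The boundary terms at the cut cancel because
  B_{k+1} has no jump for k >= 1; those at 0 and 1 leave B_j(1) - B_j(0), which is nonzero only for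
  j = 1. This one term produces the result, as the recursion otherwise ends in j = 0 with value
  0.\<close>

lemma bernpoly_convolution_aux:
  fixes y :: real
  assumes "k \<ge> 1" "0 \<le> y" "y \<le> 1"
  shows "integral {0..y} (\<lambda>x. bernpoly j x * bernpoly k (y - x)) +
         integral {y..1} (\<lambda>x. bernpoly j x * bernpoly k (y + 1 - x)) =
         (if j = 0 then 0 else - (fact j * fact k / fact (j + k)) * bernpoly (j + k) y)"
proof -
  define I1 I2 where "I1 j k = integral {0..y} (\<lambda>x. bernpoly j x * bernpoly k (y - x))"
    and "I2 j k = integral {y..1} (\<lambda>x. bernpoly j x * bernpoly k (y + 1 - x))" for j k
  have parts: "real (Suc k) * (I1 j k + I2 j k) = real j * (I1 (j - 1) (Suc k) + I2 (j - 1) (Suc k))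
      - (if j = 1 then bernpoly (Suc k) y else 0)" if "k \<ge> 1" for j k
  proof -
    have B: "bernpoly (Suc k) 1 = bernpoly (Suc k) 0" "y + 1 - y = 1" "y - y = 0" "y + 1 - 1 = y" "y - 0 = y"
      using bernpoly_1_right[of "Suc k"] that by simp_all
    have p1: "real (Suc k) * I1 j k = real j * I1 (j - 1) (Suc k)
        - (bernpoly j y * bernpoly (Suc k) 0 - bernpoly j 0 * bernpoly (Suc k) y)"
      using bernpoly_by_parts[OF assms(2), of k j y] unfolding I1_def B .
    have p2: "real (Suc k) * I2 j k = real j * I2 (j - 1) (Suc k)
        - (bernpoly j 1 * bernpoly (Suc k) y - bernpoly j y * bernpoly (Suc k) 0)"
      using bernpoly_by_parts[OF assms(3), of k j "y + 1"] unfolding I2_def B .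
    have "bernpoly j 1 * bernpoly (Suc k) y = bernpoly j 0 * bernpoly (Suc k) y + (if j = 1 then bernpoly (Suc k) y else 0)"
      by (simp add: bernpoly_1_right algebra_simps)
    with p1 p2 show ?thesis
      unfolding distrib_left by linarith
  qed
  have "I1 j k + I2 j k = (if j = 0 then 0 else - (fact j * fact k / fact (j + k)) * bernpoly (j + k) y)"
    using assms(1)
  proof (induction j arbitrary: k)
    case (0 k)
    then show ?case
      using parts[of k 0] by (simp del: of_nat_Suc)
  next
    case (Suc j k)
    have "real (Suc k) * (I1 (Suc j) k + I2 (Suc j) k) =
        real (Suc j) * (I1 j (Suc k) + I2 j (Suc k)) - (if j = 0 then bernpoly (Suc k) y else 0)"
      using parts[OF Suc.prems, of "Suc j"] by (simp del: of_nat_Suc)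
    also have "I1 j (Suc k) + I2 j (Suc k) =
        (if j = 0 then 0 else - (fact j * fact (Suc k) / fact (j + Suc k)) * bernpoly (j + Suc k) y)"
      by (intro Suc.IH) simp
    also have "real (Suc j) * \<dots> - (if j = 0 then bernpoly (Suc k) y else 0) =
        real (Suc k) * (- (fact (Suc j) * fact k / fact (Suc j + k)) * bernpoly (Suc j + k) y)"
      by (cases "j = 0") (simp_all add: mult_ac del: of_nat_Suc)
    finally have "I1 (Suc j) k + I2 (Suc j) k = - (fact (Suc j) * fact k / fact (Suc j + k)) * bernpoly (Suc j + k) y"
      by (subst (asm) mult_left_cancel) auto
    then show ?case
      by (simp del: of_nat_Suc fact_Suc)
  qed
  then show ?thesis
    by (simp add: I1_def I2_def)
qed

lemma bernpoly_convolution: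
  fixes y :: real
  assumes "j \<ge> 1" "k \<ge> 1"
  shows "((\<lambda>x. bernpoly j (frac x) * bernpoly k (frac (y - x))) has_integral
     - (fact j * fact k / fact (j + k)) * bernpoly (j + k) (frac y)) {0..1}"
proof -
  define z where "z = frac y"
  have z: "0 \<le> z" "z < 1"
    by (auto simp: z_def frac_lt_1)
  have fy: "frac (y - x) = (if x \<le> z then z - x else z + 1 - x)" if "x \<in> {0..1}" for x
  proof (cases "x \<le> z")
    case True
    then have "frac (y - x) = z - x"
      using that z by (intro frac_unique_iff[THEN iffD2]) (auto simp: z_def frac_def)
    with True show ?thesis by simp
  next
    case False
    have "y - x - (z + 1 - x) = of_int (\<lfloor>y\<rfloor> - 1)"
      by (simp add: z_def frac_def)
    then have "frac (y - x) = z + 1 - x"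
      using that z False by (intro frac_unique_iff[THEN iffD2]) (auto simp del: of_int_diff)
    with False show ?thesis by simp
  qed
  have fx: "frac x = x" if "x \<in> {0..1} - {1}" for x :: real
    using that by (simp add: frac_eq)
  have int: "(\<lambda>x. bernpoly j x * bernpoly k (s - x)) integrable_on {a..b}" for s a b
    by (intro integrable_continuous_real continuous_intros)
  have "((\<lambda>x. bernpoly j (frac x) * bernpoly k (frac (y - x))) has_integral
      integral {0..z} (\<lambda>x. bernpoly j x * bernpoly k (z - x))) {0..z}"
    using z by (intro has_integral_spike_finite[OF _ _ integrable_integral[OF int], of "{1}"]) (auto simp: fy fx)
  moreover have "((\<lambda>x. bernpoly j (frac x) * bernpoly k (frac (y - x))) has_integral
      integral {z..1} (\<lambda>x. bernpoly j x * bernpoly k (z + 1 - x))) {z..1}"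
    \<comment> \<open>At x = z the argument of the second factor is 0 and not 1, so this endpoint is
      excepted along with x = 1.\<close>
    using z by (intro has_integral_spike_finite[OF _ _ integrable_integral[OF int], of "{z, 1}"]) (auto simp: fy fx)
  ultimately have "((\<lambda>x. bernpoly j (frac x) * bernpoly k (frac (y - x))) has_integral
     (integral {0..z} (\<lambda>x. bernpoly j x * bernpoly k (z - x)) + integral {z..1} (\<lambda>x. bernpoly j x * bernpoly k (z + 1 - x)))) {0..1}"
    using z by (intro has_integral_combine) auto
  then show ?thesis
    using bernpoly_convolution_aux[of k z j] assms z by (simp add: z_def)
qed

lemma bernpoly_integral:
  assumes "k \<ge> 1"
  shows "((\<lambda>x. bernpoly k x) has_integral 0) {0..1}"
proof -
  have "(bernpoly (Suc k) has_vector_derivative real (Suc k) * bernpoly k x) (at x within {0..1})" for x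
    using has_field_derivative_at_within[OF has_real_derivative_bernpoly]
    unfolding has_real_derivative_iff_has_vector_derivative .
  then have "((\<lambda>x. real (Suc k) * bernpoly k x) has_integral (bernpoly (Suc k) 1 - bernpoly (Suc k) 0)) {0..1}"
    by (intro fundamental_theorem_of_calculus) simp_all
  from has_integral_mult_right[OF this, of "1 / real (Suc k)"]
  have "((\<lambda>x. 1 / real (Suc k) * (real (Suc k) * bernpoly k x)) has_integral 0) {0..1}"
    using bernpoly_1_right[of "Suc k"] assms by simp
  then show ?thesis
    by (simp del: of_nat_Suc)
qed

section \<open>The Haar measure of the subgroup\<close>

lemma diff_frac_in_Ints: "x - frac x \<in> \<int>"
  by (simp add: frac_def)

lemma frac_eqI: "x - y \<in> \<int> \<Longrightarrow> frac x = frac (y :: real)"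
  using Ints_add[OF _ diff_frac_in_Ints[of y], of "x - y"]
  by (simp add: frac_unique_iff[of x] frac_lt_1)

lemma sum_atLeastAtMost_last:
  fixes f :: "nat \<Rightarrow> 'a :: comm_monoid_add"
  assumes "n \<ge> 1"
  shows "(\<Sum>i=1..n. f i) = (\<Sum>i=1..<n. f i) + f n"
  using assms by (cases n) (simp_all add: atLeastLessThanSuc_atLeastAtMost add.commute)

definition torus_neg :: "nat \<Rightarrow> (nat \<Rightarrow> real) \<Rightarrow> (nat \<Rightarrow> real)" where
  "torus_neg n \<phi> = (\<lambda>i\<in>{1..n}. frac (- \<phi> i))"

lemma H_ext: "\<theta> \<in> H n \<Longrightarrow> \<theta> \<in> extensional {1..n}"
  by (auto simp: H_def torus_def PiE_def)

lemma H_frac: "\<theta> \<in> H n \<Longrightarrow> i \<in> {1..n} \<Longrightarrow> frac (\<theta> i) = \<theta> i"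
  by (auto simp: H_def torus_def PiE_def Pi_def frac_eq)

lemma restrict_frac_in_H:
  assumes "(\<Sum>i=1..n. f i) \<in> \<int>"
  shows "(\<lambda>i\<in>{1..n}. frac (f i)) \<in> H n"
proof -
  have "(\<Sum>i=1..n. f i) - (\<Sum>i=1..n. f i - frac (f i)) \<in> \<int>"
    by (intro Ints_diff assms Ints_sum diff_frac_in_Ints)
  then show ?thesis
    by (auto simp: H_def torus_def sum_subtractf frac_lt_1)
qed

lemma torus_neg_in_H: "\<phi> \<in> H n \<Longrightarrow> torus_neg n \<phi> \<in> H n"
  unfolding torus_neg_def by (rule restrict_frac_in_H) (auto simp: H_def sum_negf)

lemma torus_add_in_H: "\<phi> \<in> H n \<Longrightarrow> \<theta> \<in> H n \<Longrightarrow> torus_add n \<phi> \<theta> \<in> H n"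
  unfolding torus_add_def by (rule restrict_frac_in_H) (auto simp: H_def sum.distrib)

lemma torus_add_commute: "torus_add n \<phi> \<theta> = torus_add n \<theta> \<phi>"
  by (simp add: torus_add_def add.commute)

lemma torus_add_neg:
  assumes "\<theta> \<in> H n"
  shows "torus_add n \<phi> (torus_add n (torus_neg n \<phi>) \<theta>) = \<theta>"
    and "torus_add n (torus_neg n \<phi>) (torus_add n \<phi> \<theta>) = \<theta>"
proof -
  have "frac (\<phi> i + frac (frac (- \<phi> i) + \<theta> i)) = frac (\<theta> i)" for i
  proof -
    have "\<phi> i + (frac (- \<phi> i) + \<theta> i) - \<theta> i \<in> \<int>"
      using Ints_minus[OF diff_frac_in_Ints[of "- \<phi> i"]] by (simp add: add.commute)
    then show ?thesis
      using frac_eqI by simp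
  qed
  moreover have "frac (frac (- \<phi> i) + frac (\<phi> i + \<theta> i)) = frac (\<theta> i)" for i
    by simp
  ultimately show "torus_add n \<phi> (torus_add n (torus_neg n \<phi>) \<theta>) = \<theta>"
    "torus_add n (torus_neg n \<phi>) (torus_add n \<phi> \<theta>) = \<theta>"
    using H_ext[OF assms] H_frac[OF assms]
    by (auto simp: torus_add_def torus_neg_def extensional_def fun_eq_iff)
qed

text \<open>Invariance is formulated with images of sets, measurability with preimages. Translation
  by the inverse exchanges the two.\<close>

lemma torus_add_neg_image:
  assumes "\<phi> \<in> H n" "A \<subseteq> H n"
  shows "torus_add n (torus_neg n \<phi>) ` A = {\<theta> \<in> H n. torus_add n \<phi> \<theta> \<in> A}"
proof (intro equalityI subsetI)
  fix \<theta> assume "\<theta> \<in> torus_add n (torus_neg n \<phi>) ` A"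
  then obtain a where a: "a \<in> A" and \<theta>: "\<theta> = torus_add n (torus_neg n \<phi>) a"
    by blast
  from a assms have "a \<in> H n"
    by blast
  with a show "\<theta> \<in> {\<theta> \<in> H n. torus_add n \<phi> \<theta> \<in> A}"
    by (simp add: \<theta> torus_add_neg torus_add_in_H torus_neg_in_H assms)
next
  fix \<theta> assume "\<theta> \<in> {\<theta> \<in> H n. torus_add n \<phi> \<theta> \<in> A}"
  then have "torus_add n \<phi> \<theta> \<in> A" "\<theta> = torus_add n (torus_neg n \<phi>) (torus_add n \<phi> \<theta>)"
    by (simp_all add: torus_add_neg(2))
  then show "\<theta> \<in> torus_add n (torus_neg n \<phi>) ` A"
    using imageI[of "torus_add n \<phi> \<theta>" A "torus_add n (torus_neg n \<phi>)"] by simp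
qed

lemma torus_neg_neg: "\<phi> \<in> H n \<Longrightarrow> torus_neg n (torus_neg n \<phi>) = \<phi>"
  using H_ext[of \<phi> n] H_frac[of \<phi> n]
  by (auto simp: torus_neg_def extensional_def fun_eq_iff frac_neg_frac)

lemma torus_add_image:
  assumes "\<phi> \<in> H n" "A \<subseteq> H n"
  shows "torus_add n \<phi> ` A = {\<theta> \<in> H n. torus_add n (torus_neg n \<phi>) \<theta> \<in> A}"
  using torus_add_neg_image[OF torus_neg_in_H[OF assms(1)] assms(2)] assms(1) by (simp add: torus_neg_neg)

section \<open>Measurable group structure and uniqueness of the Haar measure\<close>

definition H_space :: "nat \<Rightarrow> (nat \<Rightarrow> real) measure" where
  "H_space n = restrict_space (Pi\<^sub>M {1..n} (\<lambda>_. borel)) (H n)"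

lemma space_H_space [simp]: "space (H_space n) = H n"
  by (auto simp: H_space_def space_restrict_space space_PiM H_def torus_def PiE_def)

lemma measurable_H_space_component [measurable]:
  assumes "i \<in> {1..n}"
  shows "(\<lambda>\<theta>. \<theta> i) \<in> borel_measurable (H_space n)"
  unfolding H_space_def using assms by (intro measurable_restrict_space1 measurable_component_singleton)

lemma measurable_torus_add [measurable]:
  "(\<lambda>(\<phi>, \<theta>). torus_add n \<phi> \<theta>) \<in> H_space n \<Otimes>\<^sub>M H_space n \<rightarrow>\<^sub>M H_space n"
proof -
  have "(\<lambda>x. torus_add n (fst x) (snd x)) \<in> H_space n \<Otimes>\<^sub>M H_space n \<rightarrow>\<^sub>M
      restrict_space (Pi\<^sub>M {1..n} (\<lambda>_. borel)) (H n)"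
  proof (rule measurable_restrict_space2)
    have [measurable]: "(\<lambda>x. fst x i) \<in> borel_measurable (H_space n \<Otimes>\<^sub>M H_space n)"
      "(\<lambda>x. snd x i) \<in> borel_measurable (H_space n \<Otimes>\<^sub>M H_space n)" if "i \<in> {1..n}" for i
      using that by (auto intro: measurable_compose[OF measurable_fst] measurable_compose[OF measurable_snd])
    show "(\<lambda>x. torus_add n (fst x) (snd x)) \<in> space (H_space n \<Otimes>\<^sub>M H_space n) \<rightarrow> H n"
      by (auto simp: space_pair_measure torus_add_in_H)
    show "(\<lambda>x. torus_add n (fst x) (snd x)) \<in> H_space n \<Otimes>\<^sub>M H_space n \<rightarrow>\<^sub>M Pi\<^sub>M {1..n} (\<lambda>_. borel)"
      unfolding torus_add_def by (intro measurable_restrict) measurable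
  qed
  then show ?thesis
    unfolding H_space_def[symmetric] case_prod_unfold .
qed

lemma haar_prob_on_H_preimage:
  assumes "haar_prob_on_H n M" "\<phi> \<in> H n" "A \<in> sets M"
  shows "emeasure M {\<theta> \<in> H n. torus_add n \<phi> \<theta> \<in> A} = emeasure M A"
proof -
  have "sets M = sets (H_space n)"
    using assms by (simp add: haar_prob_on_H_def H_space_def)
  then have "A \<subseteq> H n"
    using assms(3) sets.sets_into_space by fastforce
  then show ?thesis
    using assms torus_neg_in_H[OF assms(2)]
    by (simp add: haar_prob_on_H_def flip: torus_add_neg_image)
qed

text \<open>Both measures of \<open>A\<close> equal the product measure of \<open>{(\<phi>, \<theta>). \<phi> + \<theta> \<in> A}\<close>, computed by slicing in
  either direction.\<close>

lemma haar_prob_on_H_unique: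
  assumes "haar_prob_on_H n M" "haar_prob_on_H n N"
  shows "M = N"
proof (rule measure_eqI)
  have sM [measurable_cong]: "sets M = sets (H_space n)" and sN [measurable_cong]: "sets N = sets (H_space n)"
    using assms by (simp_all add: haar_prob_on_H_def H_space_def)
  show "sets M = sets N"
    by (simp add: sM sN)
  have spM: "space M = H n" and spN: "space N = H n"
    using sets_eq_imp_space_eq[OF sM] sets_eq_imp_space_eq[OF sN] by simp_all
  interpret M: prob_space M
    using assms by (simp add: haar_prob_on_H_def)
  interpret N: prob_space N
    using assms by (simp add: haar_prob_on_H_def)
  interpret pair_sigma_finite N M ..
  fix A
  assume A [measurable]: "A \<in> sets M"
  have A' [measurable]: "A \<in> sets (H_space n)"
    using A sM by simp
  define P where "P = (\<lambda>(\<phi>, \<theta>). torus_add n \<phi> \<theta>) -` A \<inter> space (N \<Otimes>\<^sub>M M)"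
  have meas: "(\<lambda>(\<phi>, \<theta>). torus_add n \<phi> \<theta>) \<in> N \<Otimes>\<^sub>M M \<rightarrow>\<^sub>M H_space n"
    by measurable
  have P [measurable]: "P \<in> sets (N \<Otimes>\<^sub>M M)"
    unfolding P_def using meas A' by (rule measurable_sets)
  have "emeasure (N \<Otimes>\<^sub>M M) P = (\<integral>\<^sup>+\<phi>. emeasure M (Pair \<phi> -` P) \<partial>N)"
    by (rule M.emeasure_pair_measure_alt[OF P])
  also have "\<dots> = (\<integral>\<^sup>+\<phi>. emeasure M A \<partial>N)"
  proof (rule nn_integral_cong)
    fix \<phi> assume "\<phi> \<in> space N"
    moreover from this have "Pair \<phi> -` P = {\<theta> \<in> H n. torus_add n \<phi> \<theta> \<in> A}"
      by (auto simp: P_def space_pair_measure spM spN)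
    ultimately show "emeasure M (Pair \<phi> -` P) = emeasure M A"
      using haar_prob_on_H_preimage[OF assms(1)] A by (simp add: spN)
  qed
  also have "\<dots> = emeasure M A"
    by (simp add: N.emeasure_space_1)
  finally have 1: "emeasure (N \<Otimes>\<^sub>M M) P = emeasure M A" .
  have "emeasure (N \<Otimes>\<^sub>M M) P = (\<integral>\<^sup>+\<theta>. emeasure N ((\<lambda>\<phi>. (\<phi>, \<theta>)) -` P) \<partial>M)"
    by (rule emeasure_pair_measure_alt2[OF P])
  also have "\<dots> = (\<integral>\<^sup>+\<phi>. emeasure N A \<partial>M)"
  proof (rule nn_integral_cong)
    fix \<theta> assume "\<theta> \<in> space M"
    moreover from this have "(\<lambda>\<phi>. (\<phi>, \<theta>)) -` P = {\<phi> \<in> H n. torus_add n \<theta> \<phi> \<in> A}"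
      by (auto simp: P_def space_pair_measure spM spN torus_add_commute)
    ultimately show "emeasure N ((\<lambda>\<phi>. (\<phi>, \<theta>)) -` P) = emeasure N A"
      using haar_prob_on_H_preimage[OF assms(2)] A' by (simp add: spM sN)
  qed
  also have "\<dots> = emeasure N A"
    by (simp add: M.emeasure_space_1)
  finally show "emeasure M A = emeasure N A"
    using 1 by simp
qed

section \<open>Existence of the Haar measure by push-forward of uniform coordinates\<close>

abbreviation unif :: "real measure" where
  "unif \<equiv> uniform_measure lborel {0..<1}"

lemma measurable_unif: "measurable M unif = borel_measurable M"
  by (rule measurable_cong_sets) simp_all

lemma measurable_unif_component [measurable]:
  assumes "i \<in> I"
  shows "(\<lambda>x. x i) \<in> borel_measurable (Pi\<^sub>M I (\<lambda>_. unif))"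
  using measurable_component_singleton[OF assms, of "\<lambda>_. unif"]
  by (simp only: measurable_unif)

lemma prob_space_unif: "prob_space unif"
  by (rule prob_space_uniform_measure) auto

interpretation unif: prob_space unif
  by (rule prob_space_unif)

interpretation unif_product: product_sigma_finite "\<lambda>_. unif"
  by standard

lemma unif_alt: "unif = density lborel (\<lambda>x. ennreal (indicator {0..<1} x))"
  unfolding uniform_measure_def
  by (rule arg_cong[where f = "density lborel"]) (auto simp: fun_eq_iff split: split_indicator)

text \<open>Bridge from the gauge integrals over [0, 1], in which the convolution formula is proved,
  to Lebesgue integrals. Boundedness gives integrability against a probability measure, and the
  endpoint 1 is a null set.\<close>

lemma unif_integral_eq:
  fixes f :: "real \<Rightarrow> real"
  assumes [measurable]: "f \<in> borel_measurable borel"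
    and bnd: "\<And>x. x \<in> {0..<1} \<Longrightarrow> \<bar>f x\<bar> \<le> C" and int: "(f has_integral I) {0..1}"
  shows "integrable unif f" "integral\<^sup>L unif f = I"
proof -
  have f [measurable]: "f \<in> borel_measurable unif"
    using assms(1) by (simp add: measurable_def)
  have ae: "AE x in unif. norm (f x) \<le> C"
    by (rule AE_uniform_measureI) (auto simp: bnd)
  show i: "integrable unif f"
    by (rule unif.integrable_const_bound[OF ae f])
  have ind: "(indicator {0..<1} :: real \<Rightarrow> real) \<in> borel_measurable lborel"
    by simp
  have nn: "AE x in lborel. 0 \<le> (indicator {0..<1} x :: real)"
    by (intro AE_I2 indicator_pos_le)
  have fl: "f \<in> borel_measurable lborel"
    using assms(1) unfolding measurable_lborel2 .
  have "set_integrable lborel {0..<1} f"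
    using i integrable_density[OF fl ind nn] unfolding unif_alt set_integrable_def by (rule iffD1[rotated])
  then have *: "f integrable_on {0..<1}" "(LINT x:{0..<1}|lborel. f x) = integral {0..<1} f"
    by (rule set_borel_integral_eq_integral)+
  have "integral\<^sup>L unif f = (LINT x:{0..<1}|lborel. f x)"
    unfolding unif_alt set_lebesgue_integral_def by (rule integral_density[OF fl ind nn])
  also have "\<dots> = integral {0..<1} f"
    by (rule *)
  also have "\<dots> = integral {0..1} f"
    by (rule integral_spike_set) (auto intro: negligible_subset[of "{1}"])
  also have "\<dots> = I"
    using int by (rule integral_unique)
  finally show "integral\<^sup>L unif f = I" .
qed

text \<open>A rotation of the circle, read on [0, 1), exchanges two intervals: [0, 1 - b) moves up
  by b and [1 - b, 1) moves down by 1 - b, where b = \<open>frac a\<close>. Translation invariance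
  of \<open>lborel\<close> applies to each piece.\<close>

lemma unif_shift:
  assumes "A \<in> sets borel"
  shows "emeasure unif {x. frac (x + a) \<in> A} = emeasure unif A"
proof -
  note [measurable] = assms
  define b where "b = frac a"
  have b: "0 \<le> b" "b < 1"
    by (auto simp: b_def frac_lt_1)
  have tr: "emeasure lborel {x. x + c \<in> B} = emeasure lborel B" if "B \<in> sets borel" for c :: real and B
  proof -
    have "emeasure lborel B = emeasure (distr lborel borel ((+) c)) B"
      by (simp add: lborel_distr_plus)
    also have "\<dots> = emeasure lborel {x. x + c \<in> B}"
      using that by (subst emeasure_distr) (auto simp: vimage_def add.commute)
    finally show ?thesis ..
  qed
  have fr: "frac (x + a) = (if x < 1 - b then x + b else x + (b - 1))" if "0 \<le> x" "x < 1" for x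
  proof -
    have "frac (x + a) = frac (x + b)"
      by (simp add: b_def)
    also have "\<dots> = (if x < 1 - b then x + b else x + (b - 1))"
      using that b by (auto simp: frac_unique_iff)
    finally show ?thesis .
  qed
  have "{0..<1} \<inter> {x. frac (x + a) \<in> A} = {x. x + b \<in> A \<inter> {b..<1}} \<union> {x. x + (b - 1) \<in> A \<inter> {0..<b}}"
    using b by (auto simp: fr split: if_splits)
  then have "emeasure lborel ({0..<1} \<inter> {x. frac (x + a) \<in> A}) =
      emeasure lborel ({x. x + b \<in> A \<inter> {b..<1}} \<union> {x. x + (b - 1) \<in> A \<inter> {0..<b}})"
    by simp
  also have "\<dots> = emeasure lborel {x. x + b \<in> A \<inter> {b..<1}} + emeasure lborel {x. x + (b - 1) \<in> A \<inter> {0..<b}}"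
    by (rule plus_emeasure[symmetric]) auto
  also have "\<dots> = emeasure lborel (A \<inter> {b..<1}) + emeasure lborel (A \<inter> {0..<b})"
    by (subst (1 2) tr) auto
  also have "\<dots> = emeasure lborel (A \<inter> {b..<1} \<union> A \<inter> {0..<b})"
    by (rule plus_emeasure) auto
  also have "A \<inter> {b..<1} \<union> A \<inter> {0..<b} = {0..<1} \<inter> A"
    using b by auto
  finally show ?thesis
    by (subst (1 2) emeasure_uniform_measure) auto
qed

lemma unif_PiM_shift:
  assumes "finite I"
  shows "distr (Pi\<^sub>M I (\<lambda>_. unif)) (Pi\<^sub>M I (\<lambda>_. unif)) (\<lambda>x. \<lambda>i\<in>I. frac (x i + a i)) = Pi\<^sub>M I (\<lambda>_. unif)"
proof (rule unif_product.PiM_eqI)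
  fix A :: "_ \<Rightarrow> real set"
  assume "\<And>i. i \<in> I \<Longrightarrow> A i \<in> sets unif"
  then have A [measurable]: "\<And>i. i \<in> I \<Longrightarrow> A i \<in> sets borel"
    by simp
  have "emeasure (distr (Pi\<^sub>M I (\<lambda>_. unif)) (Pi\<^sub>M I (\<lambda>_. unif)) (\<lambda>x. \<lambda>i\<in>I. frac (x i + a i))) (Pi\<^sub>E I A) =
      emeasure (Pi\<^sub>M I (\<lambda>_. unif)) ((\<lambda>x. \<lambda>i\<in>I. frac (x i + a i)) -` Pi\<^sub>E I A \<inter> space (Pi\<^sub>M I (\<lambda>_. unif)))"
    by (intro emeasure_distr measurable_restrict sets_PiM_I_finite assms) (use A in measurable)
  also have "(\<lambda>x. \<lambda>i\<in>I. frac (x i + a i)) -` Pi\<^sub>E I A \<inter> space (Pi\<^sub>M I (\<lambda>_. unif)) = (\<Pi>\<^sub>E i\<in>I. {t. frac (t + a i) \<in> A i})"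
    by (auto simp: space_PiM PiE_def Pi_def)
  also have "emeasure (Pi\<^sub>M I (\<lambda>_. unif)) \<dots> = (\<Prod>i\<in>I. emeasure unif {t. frac (t + a i) \<in> A i})"
    by (rule unif_product.emeasure_PiM[OF assms]) (use A in measurable)
  also have "\<dots> = (\<Prod>i\<in>I. emeasure unif (A i))"
    by (intro prod.cong refl unif_shift A)
  finally show "emeasure (distr (Pi\<^sub>M I (\<lambda>_. unif)) (Pi\<^sub>M I (\<lambda>_. unif)) (\<lambda>x. \<lambda>i\<in>I. frac (x i + a i))) (Pi\<^sub>E I A) =
      (\<Prod>i\<in>I. emeasure unif (A i))" .
qed (use assms in auto)

text \<open>A section of the projection of \<open>H n\<close> onto the first n - 1 coordinates.
  Applying \<open>frac\<close> everywhere lets it accept arbitrary real vectors.\<close>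

definition H_param :: "nat \<Rightarrow> (nat \<Rightarrow> real) \<Rightarrow> (nat \<Rightarrow> real)" where
  "H_param n x = (\<lambda>i\<in>{1..n}. frac (if i < n then x i else - (\<Sum>j=1..<n. x j)))"

lemma H_param_in_H:
  assumes "n \<ge> 1"
  shows "H_param n x \<in> H n"
  unfolding H_param_def
proof (rule restrict_frac_in_H)
  have "(\<Sum>i=1..<n. if i < n then x i else - (\<Sum>j=1..<n. x j)) = (\<Sum>i=1..<n. x i)"
    by (intro sum.cong) auto
  then show "(\<Sum>i=1..n. if i < n then x i else - (\<Sum>j=1..<n. x j)) \<in> \<int>"
    unfolding sum_atLeastAtMost_last[OF assms] by simp
qed

text \<open>Equivariance: translation on \<open>H n\<close> is a coordinatewise rotation of the
  parameters. The last coordinate agrees modulo 1 because the coordinates of \<open>\<phi>\<close>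
  have an integer sum. This transfers rotation invariance of the uniform measure to
  \<open>H n\<close>.\<close>

lemma torus_add_H_param:
  assumes "\<phi> \<in> H n" "n \<ge> 1"
  shows "torus_add n \<phi> (H_param n x) = H_param n (\<lambda>j\<in>{1..<n}. frac (x j + \<phi> j))"
proof
  fix i
  show "torus_add n \<phi> (H_param n x) i = H_param n (\<lambda>j\<in>{1..<n}. frac (x j + \<phi> j)) i"
  proof (cases "i \<in> {1..n}")
    case True
    show ?thesis
    proof (cases "i < n")
      case False
      define S where "S = (\<Sum>j=1..<n. x j)"
      have "(\<Sum>j=1..<n. \<phi> j) + \<phi> n \<in> \<int>"
        using assms sum_atLeastAtMost_last[of n \<phi>] by (simp add: H_def)
      moreover have "(\<Sum>j=1..<n. (x j + \<phi> j) - frac (x j + \<phi> j)) \<in> \<int>"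
        by (intro Ints_sum diff_frac_in_Ints)
      ultimately have "(\<Sum>j=1..<n. \<phi> j) + \<phi> n - (\<Sum>j=1..<n. (x j + \<phi> j) - frac (x j + \<phi> j)) \<in> \<int>"
        by (rule Ints_diff)
      also have "(\<Sum>j=1..<n. \<phi> j) + \<phi> n - (\<Sum>j=1..<n. (x j + \<phi> j) - frac (x j + \<phi> j)) =
         (\<phi> n + - S) - (- (\<Sum>j=1..<n. frac (x j + \<phi> j)))"
        by (simp add: sum_subtractf sum.distrib S_def)
      finally have "frac (\<phi> n + - S) = frac (- (\<Sum>j=1..<n. frac (x j + \<phi> j)))"
        by (rule frac_eqI)
      moreover have "i = n"
        using True False by simp
      ultimately show ?thesis
        using assms by (simp add: torus_add_def H_param_def S_def del: add_uminus_conv_diff)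
    next
      case True
      with \<open>i \<in> {1..n}\<close> show ?thesis
        by (simp add: torus_add_def H_param_def add.commute[of "x i"])
    qed
  next
    case False
    then show ?thesis
      unfolding torus_add_def H_param_def restrict_def by (simp only: if_False)
  qed
qed

lemma H_param_measurable [measurable]:
  assumes "n \<ge> 1"
  shows "H_param n \<in> Pi\<^sub>M {1..<n} (\<lambda>_. unif) \<rightarrow>\<^sub>M H_space n"
  unfolding H_space_def
proof (rule measurable_restrict_space2)
  show "H_param n \<in> space (Pi\<^sub>M {1..<n} (\<lambda>_. unif)) \<rightarrow> H n"
    using H_param_in_H[OF assms] by auto
  have "(\<lambda>x. frac (if i < n then x i else - (\<Sum>j=1..<n. x j))) \<in> borel_measurable (Pi\<^sub>M {1..<n} (\<lambda>_. unif))"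
    if "i \<in> {1..n}" for i
  proof (cases "i < n")
    case True
    with that have "i \<in> {1..<n}" by simp
    then show ?thesis
      using True by simp
  next
    case False
    then show ?thesis
      by simp
  qed
  then show "H_param n \<in> Pi\<^sub>M {1..<n} (\<lambda>_. unif) \<rightarrow>\<^sub>M Pi\<^sub>M {1..n} (\<lambda>_. borel)"
    unfolding H_param_def by (rule measurable_restrict)
qed

lemma haar_prob_on_H_distr:
  assumes "n \<ge> 1"
  shows "haar_prob_on_H n (distr (Pi\<^sub>M {1..<n} (\<lambda>_. unif)) (H_space n) (H_param n))"
    (is "haar_prob_on_H n ?M")
  unfolding haar_prob_on_H_def
proof (intro conjI ballI)
  define P where "P = Pi\<^sub>M {1..<n} (\<lambda>_. unif)"
  interpret P: prob_space P
    unfolding P_def by (intro prob_space_PiM prob_space_unif)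
  have T [measurable]: "H_param n \<in> P \<rightarrow>\<^sub>M H_space n"
    unfolding P_def by (rule H_param_measurable[OF assms])
  show "prob_space ?M"
    using P.prob_space_distr[OF T] by (simp add: P_def)
  show "sets ?M = sets (restrict_space (Pi\<^sub>M {1..n} (\<lambda>_. borel)) (H n))"
    by (simp add: H_space_def)
  fix \<phi> A
  assume \<phi>: "\<phi> \<in> H n" and "A \<in> sets ?M"
  then have A [measurable]: "A \<in> sets (H_space n)"
    by simp
  \<comment> \<open>The image of \<open>A\<close> under translation by \<open>\<phi>\<close> is its
    preimage under translation by the inverse, so the rotation \<open>S\<close> of the parameters
    uses the inverse.\<close>
  define \<psi> where "\<psi> = torus_neg n \<phi>"
  have \<psi>: "\<psi> \<in> space (H_space n)"
    using \<phi> by (simp add: \<psi>_def torus_neg_in_H)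
  define S where "S = (\<lambda>x :: nat \<Rightarrow> real. \<lambda>i\<in>{1..<n}. frac (x i + \<psi> i))"
  have comp [measurable]: "(\<lambda>x. x i) \<in> borel_measurable P" if "i \<in> {1..<n}" for i
    unfolding P_def using that by (rule measurable_unif_component)
  have S [measurable]: "S \<in> P \<rightarrow>\<^sub>M P"
  proof -
    have "(\<lambda>x. frac (x i + \<psi> i)) \<in> P \<rightarrow>\<^sub>M unif" if "i \<in> {1..<n}" for i
    proof -
      have "(\<lambda>x. frac (x i + \<psi> i)) \<in> borel_measurable P"
        using comp[OF that] by measurable
      then show ?thesis
        by (simp only: measurable_unif)
    qed
    then have "S \<in> P \<rightarrow>\<^sub>M Pi\<^sub>M {1..<n} (\<lambda>_. unif)"
      unfolding S_def by (rule measurable_restrict)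
    then show ?thesis
      by (simp only: P_def)
  qed
  have "A \<subseteq> H n"
    using sets.sets_into_space[OF A] by simp
  then have img: "torus_add n \<phi> ` A = {\<theta> \<in> H n. torus_add n \<psi> \<theta> \<in> A}"
    using \<phi> by (simp add: \<psi>_def torus_add_image)
  have "(\<lambda>\<theta>. torus_add n \<psi> \<theta>) \<in> H_space n \<rightarrow>\<^sub>M H_space n"
    using measurable_compose[OF measurable_Pair1'[OF \<psi>] measurable_torus_add] by simp
  from measurable_sets[OF this A] have img_sets: "torus_add n \<phi> ` A \<in> sets (H_space n)"
    by (simp add: img vimage_def Int_def conj_commute)
  have TS: "torus_add n \<psi> (H_param n x) = H_param n (S x)" for x
    unfolding S_def using \<psi> assms by (intro torus_add_H_param) auto
  have "emeasure ?M (torus_add n \<phi> ` A) = emeasure P (H_param n -` (torus_add n \<phi> ` A) \<inter> space P)"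
    unfolding P_def[symmetric] by (rule emeasure_distr[OF T img_sets])
  also have "H_param n -` (torus_add n \<phi> ` A) \<inter> space P = S -` (H_param n -` A \<inter> space P) \<inter> space P"
    using measurable_space[OF S] by (auto simp: img TS H_param_in_H[OF assms])
  also have "emeasure P \<dots> = emeasure (distr P P S) (H_param n -` A \<inter> space P)"
    by (rule emeasure_distr[symmetric]) auto
  also have "distr P P S = P"
    unfolding P_def S_def by (rule unif_PiM_shift) simp
  also have "emeasure P (H_param n -` A \<inter> space P) = emeasure ?M A"
    unfolding P_def[symmetric] by (rule emeasure_distr[OF T A, symmetric])
  finally show "emeasure ?M (torus_add n \<phi> ` A) = emeasure ?M A" .
qed

lemma \<mu>H_eq:
  assumes "n \<ge> 1"
  shows "\<mu>H n = distr (Pi\<^sub>M {1..<n} (\<lambda>_. unif)) (H_space n) (H_param n)"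
  unfolding \<mu>H_def
  by (intro the_equality haar_prob_on_H_distr assms) (erule haar_prob_on_H_unique[OF _ haar_prob_on_H_distr[OF assms]])

section \<open>Averages over H as iterated convolutions\<close>

lemma integrable_bernpoly_prod:
  fixes l :: nat and k :: "'i \<Rightarrow> nat"
  assumes "finite I"
  shows "integrable (Pi\<^sub>M I (\<lambda>_. unif)) (\<lambda>x. (\<Prod>i\<in>I. bernpoly (k i) (frac (x i))) * bernpoly l (frac (y - (\<Sum>i\<in>I. x i))))"
proof -
  interpret P: prob_space "Pi\<^sub>M I (\<lambda>_. unif)"
    by (intro prob_space_PiM prob_space_unif)
  obtain C where C: "\<And>k x. \<bar>bernpoly k (frac x)\<bar> \<le> C k"
    using bernpoly_frac_bounded by blast
  have C0: "C k \<ge> 0" for k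
    using C[of k 0] by (rule order.trans[OF abs_ge_zero])
  show ?thesis
  proof (rule P.integrable_const_bound)
    show "AE x in Pi\<^sub>M I (\<lambda>_. unif). norm ((\<Prod>i\<in>I. bernpoly (k i) (frac (x i))) * bernpoly l (frac (y - (\<Sum>i\<in>I. x i))))
         \<le> (\<Prod>i\<in>I. C (k i)) * C l"
      unfolding real_norm_def abs_mult abs_prod
      by (intro AE_I2 mult_mono prod_mono prod_nonneg conjI abs_ge_zero C C0)
    show "(\<lambda>x. (\<Prod>i\<in>I. bernpoly (k i) (frac (x i))) * bernpoly l (frac (y - (\<Sum>i\<in>I. x i))))
        \<in> borel_measurable (Pi\<^sub>M I (\<lambda>_. unif))"
      by measurable
  qed
qed

text \<open>The offset \<open>y\<close> and the degree \<open>l\<close> of the last factor are kept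
  free to make the induction possible: integrating out the coordinate \<open>i\<close> is one
  convolution, which replaces \<open>l\<close> by \<open>k i + l\<close> and changes the
  sign.\<close>

lemma integral_bernpoly_prod:
  fixes l :: nat and k :: "'i \<Rightarrow> nat"
  assumes "finite I" "\<And>i. i \<in> I \<Longrightarrow> k i \<ge> 1" "l \<ge> 1"
  shows "(\<integral>x. (\<Prod>i\<in>I. bernpoly (k i) (frac (x i))) * bernpoly l (frac (y - (\<Sum>i\<in>I. x i))) \<partial>Pi\<^sub>M I (\<lambda>_. unif)) =
    (-1) ^ card I * (\<Prod>i\<in>I. fact (k i)) * fact l / fact ((\<Sum>i\<in>I. k i) + l) * bernpoly ((\<Sum>i\<in>I. k i) + l) (frac y)"
  using assms
proof (induction I arbitrary: l rule: finite_induct)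
  case empty
  interpret P: prob_space "Pi\<^sub>M {} (\<lambda>_. unif)"
    by (intro prob_space_PiM prob_space_unif)
  show ?case
    by (simp add: P.prob_space)
next
  case (insert i I)
  obtain C where C: "\<And>k x. \<bar>bernpoly k (frac x)\<bar> \<le> C k"
    using bernpoly_frac_bounded by blast
  have C0: "C k \<ge> 0" for k
    using C[of k 0] by (rule order.trans[OF abs_ge_zero])
  have conv: "(\<integral>t. bernpoly (k i) (frac t) * bernpoly l (frac (s - t)) \<partial>unif) =
      - (fact (k i) * fact l / fact (k i + l)) * bernpoly (k i + l) (frac s)" for s
  proof (rule unif_integral_eq(2))
    show "((\<lambda>t. bernpoly (k i) (frac t) * bernpoly l (frac (s - t))) has_integral
        - (fact (k i) * fact l / fact (k i + l)) * bernpoly (k i + l) (frac s)) {0..1}"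
      using insert.prems by (intro bernpoly_convolution) auto
    show "\<bar>bernpoly (k i) (frac t) * bernpoly l (frac (s - t))\<bar> \<le> C (k i) * C l" for t
      unfolding abs_mult by (intro mult_mono C C0 abs_ge_zero)
  qed measurable
  \<comment> \<open>With the other coordinates fixed, the integral over coordinate \<open>i\<close>
    is a convolution evaluated at \<open>y\<close> minus their sum.\<close>
  have eq: "(\<integral>t. (\<Prod>j\<in>insert i I. bernpoly (k j) (frac ((x(i := t)) j))) * bernpoly l (frac (y - (\<Sum>j\<in>insert i I. (x(i := t)) j))) \<partial>unif) =
     - (fact (k i) * fact l / fact (k i + l)) * ((\<Prod>j\<in>I. bernpoly (k j) (frac (x j))) * bernpoly (k i + l) (frac (y - (\<Sum>j\<in>I. x j))))" for x
  proof -
    have "(\<Prod>j\<in>insert i I. bernpoly (k j) (frac ((x(i := t)) j))) * bernpoly l (frac (y - (\<Sum>j\<in>insert i I. (x(i := t)) j))) =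
      (\<Prod>j\<in>I. bernpoly (k j) (frac (x j))) * (bernpoly (k i) (frac t) * bernpoly l (frac ((y - (\<Sum>j\<in>I. x j)) - t)))" for t
    proof -
      have "(\<Prod>j\<in>I. bernpoly (k j) (frac ((x(i := t)) j))) = (\<Prod>j\<in>I. bernpoly (k j) (frac (x j)))"
        "(\<Sum>j\<in>I. (x(i := t)) j) = (\<Sum>j\<in>I. x j)"
        using insert.hyps by (auto intro!: prod.cong sum.cong)
      then show ?thesis
        using insert.hyps by (simp add: algebra_simps)
    qed
    then show ?thesis
      by (simp add: conv)
  qed
  have "(\<integral>x. (\<Prod>j\<in>insert i I. bernpoly (k j) (frac (x j))) * bernpoly l (frac (y - (\<Sum>j\<in>insert i I. x j))) \<partial>Pi\<^sub>M (insert i I) (\<lambda>_. unif)) =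
    (\<integral>x. - (fact (k i) * fact l / fact (k i + l)) * ((\<Prod>j\<in>I. bernpoly (k j) (frac (x j))) * bernpoly (k i + l) (frac (y - (\<Sum>j\<in>I. x j)))) \<partial>Pi\<^sub>M I (\<lambda>_. unif))"
    unfolding eq[symmetric] using insert.hyps
    by (intro unif_product.product_integral_insert integrable_bernpoly_prod) auto
  also have "\<dots> = - (fact (k i) * fact l / fact (k i + l)) *
     ((-1) ^ card I * (\<Prod>i\<in>I. fact (k i)) * fact (k i + l) / fact ((\<Sum>i\<in>I. k i) + (k i + l)) * bernpoly ((\<Sum>i\<in>I. k i) + (k i + l)) (frac y))"
    using insert.prems by (subst integral_mult_right_zero, subst insert.IH) auto
  also have "\<dots> = (-1) ^ card (insert i I) * (\<Prod>i\<in>insert i I. fact (k i)) * fact l / fact ((\<Sum>i\<in>insert i I. k i) + l) *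
      bernpoly ((\<Sum>i\<in>insert i I. k i) + l) (frac y)"
    using insert.hyps by (simp add: add_ac mult_ac)
  finally show ?case .
qed

lemma prod_atLeastAtMost_last:
  fixes f :: "nat \<Rightarrow> 'a :: comm_monoid_mult"
  assumes "n \<ge> 1"
  shows "(\<Prod>i=1..n. f i) = (\<Prod>i=1..<n. f i) * f n"
  using assms by (cases n) (simp_all add: atLeastLessThanSuc_atLeastAtMost mult.commute)

text \<open>Pulling back along \<open>H_param\<close> turns the n-th factor into the last factor of
  the convolution formula, with offset 0; the other n - 1 coordinates are the variables of
  integration.\<close>

lemma \<mu>H_bernpoly_prod:
  fixes k :: "nat \<Rightarrow> nat"
  assumes n: "n \<ge> 1" and k: "\<And>i. i \<in> {1..n} \<Longrightarrow> k i \<ge> 1"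
  shows "integrable (\<mu>H n) (\<lambda>\<theta>. \<Prod>i=1..n. bernpoly (k i) (\<theta> i))"
    and "(\<integral>\<theta>. (\<Prod>i=1..n. bernpoly (k i) (\<theta> i)) \<partial>\<mu>H n) =
       (-1) ^ (n + 1) * (\<Prod>i=1..n. fact (k i)) / fact (\<Sum>i=1..n. k i) * bernoulli (\<Sum>i=1..n. k i)"
proof -
  note T = H_param_measurable[OF n]
  have f [measurable]: "(\<lambda>\<theta>. \<Prod>i=1..n. bernpoly (k i) (\<theta> i)) \<in> borel_measurable (H_space n)"
    by (intro borel_measurable_prod) measurable
  have eq: "(\<Prod>i=1..n. bernpoly (k i) (H_param n x i)) =
      (\<Prod>i=1..<n. bernpoly (k i) (frac (x i))) * bernpoly (k n) (frac (0 - (\<Sum>i=1..<n. x i)))" for x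
    using n by (subst prod_atLeastAtMost_last) (auto simp: H_param_def intro!: prod.cong)
  show "integrable (\<mu>H n) (\<lambda>\<theta>. \<Prod>i=1..n. bernpoly (k i) (\<theta> i))"
    unfolding \<mu>H_eq[OF n] integrable_distr_eq[OF T f] eq by (rule integrable_bernpoly_prod) simp
  have "(\<integral>\<theta>. (\<Prod>i=1..n. bernpoly (k i) (\<theta> i)) \<partial>\<mu>H n) =
      (-1) ^ card {1..<n} * (\<Prod>i=1..<n. fact (k i)) * fact (k n) / fact ((\<Sum>i=1..<n. k i) + k n) *
      bernpoly ((\<Sum>i=1..<n. k i) + k n) (frac 0)"
    unfolding \<mu>H_eq[OF n] integral_distr[OF T f] eq using n k by (intro integral_bernpoly_prod) auto
  \<comment> \<open>The n - 1 sign changes are written with the exponent n + 1, which avoids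
    truncated subtraction.\<close>
  also have "\<dots> = (-1) ^ (n + 1) * (\<Prod>i=1..n. fact (k i)) / fact (\<Sum>i=1..n. k i) * bernoulli (\<Sum>i=1..n. k i)"
    using n by (subst (1 2) sum_atLeastAtMost_last[OF n], subst prod_atLeastAtMost_last[OF n])
      (cases n; simp add: bernoulli_def mult_ac)
  finally show "(\<integral>\<theta>. (\<Prod>i=1..n. bernpoly (k i) (\<theta> i)) \<partial>\<mu>H n) =
       (-1) ^ (n + 1) * (\<Prod>i=1..n. fact (k i)) / fact (\<Sum>i=1..n. k i) * bernoulli (\<Sum>i=1..n. k i)" .
qed

lemma uniform_cube_bernpoly_2:
  assumes "n \<ge> 1"
  shows "integrable (uniform_cube n) (\<lambda>\<theta>. \<Prod>i=1..n. bernpoly 2 (\<theta> i))"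
    and "(\<integral>\<theta>. (\<Prod>i=1..n. bernpoly 2 (\<theta> i)) \<partial>uniform_cube n) = 0"
proof -
  obtain C where C: "\<And>k x. \<bar>bernpoly k (frac x)\<bar> \<le> C k"
    using bernpoly_frac_bounded by blast
  have bnd: "\<bar>bernpoly 2 x\<bar> \<le> C 2" if "x \<in> {0..<1}" for x
    using C[of 2 x] that by simp
  note * = unif_integral_eq[OF bernpoly_measurable bnd bernpoly_integral[of 2]]
  show "integrable (uniform_cube n) (\<lambda>\<theta>. \<Prod>i=1..n. bernpoly 2 (\<theta> i))"
    unfolding uniform_cube_def by (intro unif_product.product_integrable_prod *) auto
  have "(\<integral>\<theta>. (\<Prod>i=1..n. bernpoly 2 (\<theta> i)) \<partial>uniform_cube n) = (\<Prod>i=1..n. integral\<^sup>L unif (bernpoly 2))"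
    unfolding uniform_cube_def by (intro unif_product.product_integral_prod *) auto
  also have "\<dots> = 0"
    using assms by (subst *) auto
  finally show "(\<integral>\<theta>. (\<Prod>i=1..n. bernpoly 2 (\<theta> i)) \<partial>uniform_cube n) = 0" .
qed

section \<open>Expansion into single-bin functions\<close>

abbreviation bins :: "nat \<Rightarrow> nat option set" where
  "bins n \<equiv> insert None (Some ` {1..n})"

lemma c_eq_sum_summands: "c n p k \<theta> = (\<Sum>b\<in>bins n. c_summand p k b \<theta>)"
proof -
  have "(\<Sum>b\<in>bins n. c_summand p k b \<theta>) = c_summand p k None \<theta> + (\<Sum>i=1..n. c_summand p k (Some i) \<theta>)"
    by (subst sum.insert) (auto simp: sum.reindex)
  then show ?thesis
    by (simp add: c_def sum_negf sum_distrib_left right_diff_distrib mult_ac)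
qed

lemma length_le_sum_list: "(\<And>x. x \<in> set xs \<Longrightarrow> 1 \<le> x) \<Longrightarrow> length xs \<le> sum_list xs" for xs :: "nat list"
  by (induction xs) force+

lemma length_eq_sum_list:
  fixes xs :: "nat list"
  assumes "\<And>x. x \<in> set xs \<Longrightarrow> 1 \<le> x" "sum_list xs = length xs"
  shows "xs = replicate (length xs) 1"
  using assms
proof (induction xs)
  case (Cons x xs)
  have "length xs \<le> sum_list xs" "x \<ge> 1"
    using Cons.prems by (auto intro: length_le_sum_list)
  with Cons.prems(2) have "x = 1" "sum_list xs = length xs"
    by auto
  with Cons show ?case
    by simp
qed simp

lemma expansion_fst_ge_1: "ts \<in> expansion n j \<Longrightarrow> x \<in> set (map fst ts) \<Longrightarrow> 1 \<le> x"
  by (auto simp: expansion_def)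

lemma expansion_length_le: "ts \<in> expansion n j \<Longrightarrow> length ts \<le> j"
  using length_le_sum_list[of "map fst ts"] expansion_fst_ge_1[of ts n j] by (simp add: expansion_def)

text \<open>Since all weights are positive, the total j bounds each weight as well as the number of
  factors.\<close>

lemma finite_expansion: "finite (expansion n j)"
proof (rule finite_subset)
  show "expansion n j \<subseteq> {ts. set ts \<subseteq> {1..j} \<times> bins n \<and> length ts \<le> j}"
  proof
    fix ts assume ts: "ts \<in> expansion n j"
    have "x \<in> {1..j} \<times> bins n" if "x \<in> set ts" for x
    proof -
      have "fst x \<le> j"
        using member_le_sum_list[of "fst x" "map fst ts"] ts that by (simp add: expansion_def)
      moreover have "x \<in> {1..} \<times> bins n"
        using ts that unfolding expansion_def by blast
      ultimately show ?thesis
        by (simp add: mem_Times_iff)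
    qed
    then show "ts \<in> {ts. set ts \<subseteq> {1..j} \<times> bins n \<and> length ts \<le> j}"
      using expansion_length_le[OF ts] by blast
  qed
  show "finite {ts. set ts \<subseteq> {1..j} \<times> bins n \<and> length ts \<le> j}"
    by (intro finite_lists_length_le) auto
qed

text \<open>Multiplying by one more copy of the series chooses a weight and a summand for a new
  first factor, so the Cauchy product corresponds to \<open>Cons\<close> on lists of
  choices.\<close>

lemma c_fps_power_nth:
  "fps_nth (Abs_fps (\<lambda>k. if k = 0 then 0 else c n p k \<theta>) ^ l) j =
     (\<Sum>ts | ts \<in> expansion n j \<and> length ts = l. \<Prod>(r, b)\<leftarrow>ts. c_summand p r b \<theta>)"
proof (induction l arbitrary: j)
  case 0
  have "{ts \<in> expansion n j. length ts = 0} = (if j = 0 then {[]} else {})"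
    by (auto simp: expansion_def)
  then show ?case
    by simp
next
  case (Suc l)
  let ?A = "\<lambda>l j. {ts \<in> expansion n j. length ts = l}"
  let ?C = "Abs_fps (\<lambda>k. if k = 0 then 0 else c n p k \<theta>)"
  let ?w = "\<lambda>ts. \<Prod>(r, b)\<leftarrow>ts. c_summand p r b \<theta>"
  have fin: "finite (?A l j)" for l j
    using finite_expansion[of n j] by simp
  have "fps_nth (?C ^ Suc l) j = (\<Sum>i=0..j. fps_nth ?C i * fps_nth (?C ^ l) (j - i))"
    by (simp add: fps_mult_nth)
  \<comment> \<open>The series has constant coefficient 0, which matches the requirement that
    weights be positive.\<close>
  also have "\<dots> = (\<Sum>i=1..j. c n p i \<theta> * fps_nth (?C ^ l) (j - i))"
    by (rule sum.mono_neutral_cong_right) auto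
  also have "\<dots> = (\<Sum>i=1..j. \<Sum>b\<in>bins n. \<Sum>ts\<in>?A l (j - i). c_summand p i b \<theta> * ?w ts)"
    unfolding Suc.IH unfolding c_eq_sum_summands sum_product ..
  also have "\<dots> = (\<Sum>(i, b)\<in>{1..j} \<times> bins n. \<Sum>ts\<in>?A l (j - i). c_summand p i b \<theta> * ?w ts)"
    by (rule sum.cartesian_product)
  also have "\<dots> = (\<Sum>x\<in>{1..j} \<times> bins n. \<Sum>ts\<in>?A l (j - fst x). c_summand p (fst x) (snd x) \<theta> * ?w ts)"
    by (simp only: case_prod_unfold)
  also have "\<dots> = (\<Sum>(x, ts)\<in>Sigma ({1..j} \<times> bins n) (\<lambda>x. ?A l (j - fst x)). c_summand p (fst x) (snd x) \<theta> * ?w ts)"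
    by (intro sum.Sigma ballI fin) auto
  also have "\<dots> = (\<Sum>ts\<in>?A (Suc l) j. ?w ts)"
  proof (rule sum.reindex_bij_witness[of _ "\<lambda>ts. (hd ts, tl ts)" "\<lambda>(x, ts). x # ts"], goal_cases)
    case (4 ts)
    then show ?case
      by (cases ts) (auto simp: expansion_def)
  next
    case (5 ts)
    then show ?case
      by (cases ts) (auto simp: expansion_def)
  qed (auto simp: expansion_def length_Suc_conv)
  finally show ?case .
qed

text \<open>The l-th power in the exponential series accounts for the lists of length l, and no list
  of total weight j is longer than j.\<close>

lemma Q_expansion: "Q n p j \<theta> = (\<Sum>ts\<in>expansion n j. term_value p ts \<theta>)"
proof -
  have "Q n p j \<theta> = (\<Sum>l=0..j. \<Sum>ts | ts \<in> expansion n j \<and> length ts = l. term_value p ts \<theta>)"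
    unfolding Q_def fps_compose_nth c_fps_power_nth
    by (intro sum.cong refl) (auto simp: sum_distrib_left term_value_def intro!: sum.cong)
  also have "\<dots> = (\<Sum>ts\<in>expansion n j. term_value p ts \<theta>)"
    using expansion_length_le by (intro sum.group finite_expansion) auto
  finally show ?thesis .
qed

lemma involves_all_length:
  assumes "involves_all n ts"
  shows "n \<le> length ts"
proof -
  have "card (Some ` {1..n}) \<le> card (snd ` set ts)"
    using assms by (intro card_mono) (auto simp: involves_all_def)
  also have "\<dots> \<le> length ts"
    using card_image_le[of "set ts" snd] card_length[of ts] by simp
  finally show ?thesis
    by (simp add: card_image)
qed

lemma involves_all_imp_le:
  assumes "ts \<in> expansion n j" "involves_all n ts"
  shows "n \<le> j"
  using involves_all_length[OF assms(2)] expansion_length_le[OF assms(1)] by simp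

text \<open>Describing these terms by their length identifies them with the terms of the coefficient
  of degree n in the n-th power of the series of the \<open>c n p k \<theta>\<close>.\<close>

lemma c1_power_terms_altdef: "c1_power_terms n = {ts \<in> expansion n n. length ts = n}"
proof (intro equalityI subsetI)
  fix ts assume ts: "ts \<in> c1_power_terms n"
  then have "map fst ts = replicate n 1"
    by (simp add: c1_power_terms_def)
  then have "length ts = n"
    by (metis length_map length_replicate)
  with ts show "ts \<in> {ts \<in> expansion n n. length ts = n}"
    by (simp add: c1_power_terms_def)
next
  fix ts assume ts: "ts \<in> {ts \<in> expansion n n. length ts = n}"
  have "map fst ts = replicate (length (map fst ts)) 1"
  proof (rule length_eq_sum_list)
    show "1 \<le> x" if "x \<in> set (map fst ts)" for x
      using ts that expansion_fst_ge_1 by blast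
    show "sum_list (map fst ts) = length (map fst ts)"
      using ts by (simp add: expansion_def)
  qed
  with ts show "ts \<in> c1_power_terms n"
    by (simp add: c1_power_terms_def)
qed

lemma sum_c1_power_terms:
  "(\<Sum>ts\<in>c1_power_terms n. term_value p ts \<theta>) = 1 / fact n * c n p 1 \<theta> ^ n"
proof -
  let ?C = "Abs_fps (\<lambda>k. if k = 0 then 0 else c n p k \<theta>)"
  have "(\<Sum>ts\<in>c1_power_terms n. term_value p ts \<theta>) = 1 / fact n * fps_nth (?C ^ n) n"
    unfolding c_fps_power_nth c1_power_terms_altdef sum_distrib_left
    by (intro sum.cong) (auto simp: term_value_def)
  also have "fps_nth (?C ^ n) n = c n p 1 \<theta> ^ n"
    by (subst startsby_zero_power_nth_same) simp_all
  finally show ?thesis .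
qed

lemma involves_all_expansion_subset: "{ts \<in> expansion n n. involves_all n ts} \<subseteq> c1_power_terms n"
  unfolding c1_power_terms_altdef
proof clarify
  fix ts assume "ts \<in> expansion n n" "involves_all n ts"
  then show "length ts = n"
    using involves_all_length[of n ts] expansion_length_le[of ts n n] by simp
qed

lemma involves_all_expansion_eq:
  "{ts \<in> expansion n n. involves_all n ts} = map (\<lambda>i. (1 :: nat, Some i)) ` permutations_of_set {1..n}"
proof (intro equalityI subsetI)
  fix ts assume ts: "ts \<in> {ts \<in> expansion n n. involves_all n ts}"
  then have "ts \<in> c1_power_terms n"
    using involves_all_expansion_subset by blast
  then have "map fst ts = replicate n 1"
    by (simp add: c1_power_terms_def)
  then have len: "length ts = n" and "set (map fst ts) \<subseteq> {1}"
    by (metis length_map length_replicate, auto)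
  then have fst: "fst x = 1" if "x \<in> set ts" for x
    using that by auto
  have "Some ` {1..n} \<subseteq> snd ` set ts"
    using ts by (auto simp: involves_all_def)
  \<comment> \<open>With only n positions for n coordinates, counting excludes both the constant
    summand and repetitions.\<close>
  moreover have "card (snd ` set ts) \<le> card (Some ` {1..n})"
    using card_length[of "map snd ts"] len by (simp add: card_image)
  ultimately have set: "snd ` set ts = Some ` {1..n}"
    by (intro card_seteq[symmetric]) auto
  define xs where "xs = map (\<lambda>x. the (snd x)) ts"
  have "set xs = the ` (snd ` set ts)"
    by (simp add: xs_def image_image)
  also have "\<dots> = {1..n}"
    unfolding set by (simp add: image_image)
  finally have "set xs = {1..n}" .
  moreover from this have "distinct xs"
    by (intro card_distinct) (simp add: xs_def len)
  moreover have "(1, Some (the (snd x))) = x" if "x \<in> set ts" for x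
  proof -
    have "snd x \<in> Some ` {1..n}"
      using that set by blast
    then show ?thesis
      using fst[OF that] by (cases x) auto
  qed
  then have "map (\<lambda>i. (1 :: nat, Some i)) xs = ts"
    unfolding xs_def map_map by (intro map_idI) simp
  ultimately show "ts \<in> map (\<lambda>i. (1 :: nat, Some i)) ` permutations_of_set {1..n}"
    by (metis image_eqI permutations_of_setI)
next
  fix ts assume "ts \<in> map (\<lambda>i. (1 :: nat, Some i)) ` permutations_of_set {1..n}"
  then obtain xs where xs: "set xs = {1..n}" "distinct xs" "ts = map (\<lambda>i. (1 :: nat, Some i)) xs"
    by (auto simp: permutations_of_set_def)
  have "length xs = n"
    using distinct_card[OF xs(2)] xs(1) by simp
  then have "sum_list (map fst ts) = n"
    by (simp add: xs(3) o_def sum_list_triv)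
  then show "ts \<in> {ts \<in> expansion n n. involves_all n ts}"
    using xs by (auto simp: expansion_def involves_all_def image_image)
qed

text \<open>The n! orderings all contribute the same product, cancelling the denominator
  \<open>fact n\<close>. The factor - 1 / 2 is the coefficient of B_2 in \<open>c n p 1\<close>,
  apart from the inverse of \<open>p i\<close>.\<close>

lemma sum_involves_all:
  "(\<Sum>ts | ts \<in> expansion n n \<and> involves_all n ts. term_value p ts \<theta>) =
     (- 1 / 2) ^ n * (\<Prod>i=1..n. inverse (p i)) * (\<Prod>i=1..n. bernpoly 2 (\<theta> i))"
proof -
  let ?P = "\<Prod>i=1..n. c_summand p 1 (Some i) \<theta>"
  have "term_value p (map (\<lambda>i. (1, Some i)) xs) \<theta> = ?P / fact n" if "xs \<in> permutations_of_set {1..n}" for xs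
  proof -
    from that have xs: "set xs = {1..n}" "distinct xs"
      by (auto simp: permutations_of_set_def)
    have "length xs = n"
      using distinct_card[OF xs(2)] xs(1) by simp
    then show ?thesis
      using prod.distinct_set_conv_list[OF xs(2), of "\<lambda>i. c_summand p 1 (Some i) \<theta>"] xs(1)
      by (simp add: term_value_def o_def del: c_summand.simps)
  qed
  moreover have "inj_on (map (\<lambda>i. (1 :: nat, Some i))) (permutations_of_set {1..n})"
    by (intro inj_on_subset[OF inj_mapI]) (auto simp: inj_def)
  ultimately have "(\<Sum>ts | ts \<in> expansion n n \<and> involves_all n ts. term_value p ts \<theta>) =
      (\<Sum>xs\<in>permutations_of_set {1..n}. ?P / fact n)"
    unfolding involves_all_expansion_eq by (subst sum.reindex) (auto intro!: sum.cong)
  also have "\<dots> = ?P"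
    by simp
  also have "?P = (\<Prod>i=1..n. (- 1 / 2) * inverse (p i) * bernpoly 2 (\<theta> i))"
    by (intro prod.cong refl) (simp add: numeral_2_eq_2[symmetric] bernpoly_2 field_simps power2_eq_square)
  also have "\<dots> = (- 1 / 2) ^ n * (\<Prod>i=1..n. inverse (p i)) * (\<Prod>i=1..n. bernpoly 2 (\<theta> i))"
    by (simp only: prod.distrib prod_constant card_atLeastAtMost) simp
  finally show ?thesis .
qed

section \<open>Sums of Fourier coefficients over nonzero integers\<close>

lemma bernpoly_fourier_prod:
  "(\<Prod>i=1..n. bernpoly_fourier (k i) m) =
     (-1) ^ n * (\<Prod>i=1..n. fact (k i)) / (2 * of_real pi * \<i>) ^ (\<Sum>i=1..n. k i) / of_int m ^ (\<Sum>i=1..n. k i)"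
proof -
  have "bernpoly_fourier (k i) m = (- 1) * fact (k i) / ((2 * of_real pi * \<i>) ^ k i * of_int m ^ k i)" for i
    by (simp add: bernpoly_fourier_def power_mult_distrib)
  then have "(\<Prod>i=1..n. bernpoly_fourier (k i) m) =
      (\<Prod>i=1..n. (- 1) * fact (k i) / ((2 * of_real pi * \<i>) ^ k i * of_int m ^ k i))"
    by simp
  also have "\<dots> = (-1) ^ n * (\<Prod>i=1..n. fact (k i)) /
      ((2 * of_real pi * \<i>) ^ (\<Sum>i=1..n. k i) * of_int m ^ (\<Sum>i=1..n. k i))"
    by (simp only: prod_dividef prod.distrib prod_constant power_sum card_atLeastAtMost) simp
  finally show ?thesis
    by simp
qed

text \<open>Positive and negative integers each contribute zeta(K) up to the sign (-1)^K, which is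
  why odd K gives 0.\<close>

lemma has_sum_inverse_int_power:
  assumes "K \<ge> 2"
  shows "((\<lambda>m. 1 / of_int m ^ K) has_sum ((1 + (-1) ^ K) * of_real (zeta (real K)) :: complex)) (UNIV - {0})"
proof -
  have pos: "((\<lambda>j. 1 / of_nat (Suc j) ^ K) has_sum (of_real (zeta (real K)) :: complex)) UNIV"
  proof -
    have "((\<lambda>j. 1 / real (Suc j) ^ K) has_sum zeta (real K)) UNIV"
      using zeta_sums[OF assms] by (intro sums_nonneg_imp_has_sum) auto
    then have "((\<lambda>j. of_real (1 / real (Suc j) ^ K)) has_sum (of_real (zeta (real K)) :: complex)) UNIV"
      by (rule has_sum_of_real)
    then show ?thesis
      by (simp del: of_nat_Suc)
  qed
  have neg: "((\<lambda>j. (-1) ^ K * (1 / of_nat (Suc j) ^ K)) has_sum ((-1) ^ K * of_real (zeta (real K)) :: complex)) UNIV"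
    by (rule has_sum_cmult_right[OF pos])
  let ?P = "\<lambda>j. int (Suc j)" and ?N = "\<lambda>j. - int (Suc j)"
  have "inj ?P" "inj ?N"
    by (auto simp: inj_def)
  moreover have "(\<lambda>m. 1 / of_int m ^ K) \<circ> ?P = (\<lambda>j. 1 / (of_nat (Suc j) :: complex) ^ K)"
    by (simp add: fun_eq_iff)
  moreover have "(\<lambda>m. 1 / of_int m ^ K) \<circ> ?N = (\<lambda>j. (-1) ^ K * (1 / (of_nat (Suc j) :: complex) ^ K))"
  proof
    fix j
    define z :: complex where "z = of_nat (Suc j)"
    have "1 / (- z) ^ K = (-1) ^ K * (1 / z ^ K)"
      by (cases "even K") auto
    then show "((\<lambda>m. 1 / of_int m ^ K) \<circ> ?N) j = (-1) ^ K * (1 / (of_nat (Suc j) :: complex) ^ K)"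
      by (simp add: z_def)
  qed
  ultimately have 1: "((\<lambda>m. 1 / of_int m ^ K) has_sum (of_real (zeta (real K)) :: complex)) (range ?P)"
    and 2: "((\<lambda>m. 1 / of_int m ^ K) has_sum ((-1) ^ K * of_real (zeta (real K)) :: complex)) (range ?N)"
    using pos neg by (simp_all only: has_sum_reindex)
  have "m \<in> range ?P \<union> range ?N" if "m \<noteq> 0" for m
    using that by (cases m rule: int_cases2) (auto simp: image_iff gr0_conv_Suc)
  then have "UNIV - {0} = range ?P \<union> range ?N"
    by auto
  moreover have "range ?P \<inter> range ?N = {}"
    by auto
  ultimately show ?thesis
    using has_sum_Un_disjoint[OF 1 2] by (simp add: distrib_right)
qed

section \<open>The averages\<close>

lemma integral_eq_zeta:
  fixes k :: "nat \<Rightarrow> nat" and n :: nat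
  defines "K \<equiv> (\<Sum>i=1..n. k i)"
  assumes "K \<ge> 2"
  shows "(-1) ^ (n + 1) * (\<Prod>i=1..n. fact (k i)) / fact K * bernoulli K =
     (if even K then 2 * (-1) powi (int n - int (K div 2)) * (\<Prod>i=1..n. fact (k i)) * zeta (real K) / (2 * pi) ^ K
      else 0)"
proof (cases "even K")
  case True
  \<comment> \<open>The exponent n - K / 2 can be negative, hence an integer power; - 1 is its own
    inverse, so it splits into natural powers.\<close>
  have "(-1 :: real) powi (int n - int (K div 2)) = (-1) ^ n * (-1) ^ (K div 2)"
    by (cases "even (K div 2)") (simp_all add: power_int_diff)
  with True show ?thesis
    by (simp add: bernoulli_eq_zeta[OF assms(2)])
qed (simp add: bernoulli_eq_zeta[OF assms(2)])

text \<open>The m-independent factor \<open>D\<close> is pulled out, the remaining sum is a multiple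
  of zeta(K), and Euler's formula converts it back to \<open>bernoulli K\<close>. For odd K both
  sides are 0.\<close>

lemma has_sum_bernpoly_fourier_prod:
  fixes k :: "nat \<Rightarrow> nat" and n :: nat
  defines "K \<equiv> (\<Sum>i=1..n. k i)"
  assumes "K \<ge> 2"
  shows "((\<lambda>m. \<Prod>i=1..n. bernpoly_fourier (k i) m) has_sum
     complex_of_real ((-1) ^ (n + 1) * (\<Prod>i=1..n. fact (k i)) / fact K * bernoulli K)) (UNIV - {0})"
proof -
  define D :: complex where "D = (-1) ^ n * (\<Prod>i=1..n. fact (k i)) / (2 * of_real pi * \<i>) ^ K"
  have "((\<lambda>m. D * (1 / of_int m ^ K)) has_sum (D * ((1 + (-1) ^ K) * of_real (zeta (real K))))) (UNIV - {0})"
    by (intro has_sum_cmult_right has_sum_inverse_int_power assms(2))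
  moreover have "(\<Prod>i=1..n. bernpoly_fourier (k i) m) = D * (1 / of_int m ^ K)" for m
    unfolding bernpoly_fourier_prod D_def K_def by simp
  moreover have "D * ((1 + (-1) ^ K) * of_real (zeta (real K))) =
      complex_of_real ((-1) ^ (n + 1) * (\<Prod>i=1..n. fact (k i)) / fact K * bernoulli K)"
  proof (cases "even K")
    case True
    then have "(2 * of_real pi * \<i>) ^ K = (2 * of_real pi) ^ K * (-1 :: complex) ^ (K div 2)"
      by (auto simp: power_mult_distrib elim!: evenE)
    then have "D = (-1) ^ n * (\<Prod>i=1..n. fact (k i)) * (-1) ^ (K div 2) / (2 * of_real pi) ^ K"
      unfolding D_def by (cases "even (K div 2)") simp_all
    with True show ?thesis
      by (simp add: bernoulli_eq_zeta[OF assms(2)])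
  qed (simp add: bernoulli_eq_zeta[OF assms(2)])
  ultimately show ?thesis
    by simp
qed

lemma bernoulli_even_eq_zeta:
  assumes "n \<ge> 1"
  shows "(-1) ^ (n + 1) * 2 ^ n * bernoulli (2 * n) / fact (2 * n) = 2 * zeta (real (2 * n)) / (2 * pi\<^sup>2) ^ n"
proof -
  have "(2 * pi) ^ (2 * n) = 2 ^ n * (2 * pi\<^sup>2) ^ n"
  proof -
    have "(2 * pi)\<^sup>2 = 2 * (2 * pi\<^sup>2)"
      by (simp add: power2_eq_square)
    then show ?thesis
      by (simp only: power_mult power_mult_distrib)
  qed
  moreover have "(-1 :: real) ^ n * (-1) ^ n = 1"
    by (cases "even n") simp_all
  ultimately show ?thesis
    using assms by (simp add: bernoulli_eq_zeta)
qed

theorem proposition6p2: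
  fixes n :: nat and p :: "nat \<Rightarrow> real"
  assumes "n \<ge> 2"
    and "\<And>i. i \<in> {1..n} \<Longrightarrow> p i > 0"
    and "(\<Sum>i=1..n. p i) = 1"
    and "generic n p"
  shows
    \<comment> \<open>expansion of the coefficients into single-bin functions; first term involving all coordinates\<close>
    "(\<forall>j. \<forall>\<theta>\<in>torus n. Q n p j \<theta> = (\<Sum>ts\<in>expansion n j. term_value p ts \<theta>)) \<and>
     (\<forall>j<n. \<forall>ts\<in>expansion n j. \<not> involves_all n ts) \<and>
     (\<forall>\<theta>\<in>torus n. (\<Sum>ts\<in>c1_power_terms n. term_value p ts \<theta>) = 1 / fact n * c n p 1 \<theta> ^ n) \<and>
     {ts \<in> expansion n n. involves_all n ts} \<noteq> {} \<and>
     {ts \<in> expansion n n. involves_all n ts} \<subseteq> c1_power_terms n \<and>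
     (\<forall>\<theta>\<in>torus n. (\<Sum>ts | ts \<in> expansion n n \<and> involves_all n ts. term_value p ts \<theta>) =
        (- 1 / 2) ^ n * (\<Prod>i=1..n. inverse (p i)) * (\<Prod>i=1..n. bernpoly 2 (\<theta> i))) \<and>
     \<comment> \<open>averages of the product of the second Bernoulli polynomials\<close>
     integrable (\<mu>H n) (\<lambda>\<theta>. \<Prod>i=1..n. bernpoly 2 (\<theta> i)) \<and>
     (\<integral>\<theta>. (\<Prod>i=1..n. bernpoly 2 (\<theta> i)) \<partial>\<mu>H n) \<noteq> 0 \<and>
     (\<integral>\<theta>. (\<Prod>i=1..n. bernpoly 2 (\<theta> i)) \<partial>\<mu>H n) =
        (-1) ^ (n + 1) * 2 ^ n * bernoulli (2 * n) / fact (2 * n) \<and>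
     (-1) ^ (n + 1) * 2 ^ n * bernoulli (2 * n) / fact (2 * n) =
        2 * zeta (real (2 * n)) / (2 * pi\<^sup>2) ^ n \<and>
     integrable (uniform_cube n) (\<lambda>\<theta>. \<Prod>i=1..n. bernpoly 2 (\<theta> i)) \<and>
     (\<integral>\<theta>. (\<Prod>i=1..n. bernpoly 2 (\<theta> i)) \<partial>uniform_cube n) = 0 \<and>
     \<comment> \<open>Fourier coefficients of the periodised Bernoulli polynomials\<close>
     (\<forall>k\<ge>1. \<forall>m. m \<noteq> 0 \<longrightarrow>
        ((\<lambda>x. of_real (bernpoly k (frac x)) * exp (- (2 * of_real pi * \<i> * of_int m * of_real x)))
           has_integral bernpoly_fourier k m) {0..1}) \<and>
     \<comment> \<open>averages of products of arbitrary Bernoulli polynomials\<close>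
     (\<forall>k :: nat \<Rightarrow> nat. (\<forall>i\<in>{1..n}. k i \<ge> 1) \<longrightarrow>
        (let K = (\<Sum>i=1..n. k i);
             E = (\<integral>\<theta>. (\<Prod>i=1..n. bernpoly (k i) (\<theta> i)) \<partial>\<mu>H n)
         in integrable (\<mu>H n) (\<lambda>\<theta>. \<Prod>i=1..n. bernpoly (k i) (\<theta> i)) \<and>
            ((\<lambda>m. \<Prod>i=1..n. bernpoly_fourier (k i) m) has_sum complex_of_real E) (UNIV - {0}) \<and>
            E = (if even K
                 then 2 * (-1) powi (int n - int (K div 2)) * (\<Prod>i=1..n. fact (k i)) *
                        zeta (real K) / (2 * pi) ^ K
                 else 0)))"
proof -
  from assms(1) have n: "n \<ge> 1"
    by simp
  have E2: "(\<integral>\<theta>. (\<Prod>i=1..n. bernpoly 2 (\<theta> i)) \<partial>\<mu>H n) = (-1) ^ (n + 1) * 2 ^ n * bernoulli (2 * n) / fact (2 * n)"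
    using \<mu>H_bernpoly_prod(2)[OF n, of "\<lambda>_. 2"] by (simp add: mult.commute)
  have "zeta (real (2 * n)) > 0"
    using n by (intro zeta_pos) simp
  then have E2_nz: "(\<integral>\<theta>. (\<Prod>i=1..n. bernpoly 2 (\<theta> i)) \<partial>\<mu>H n) \<noteq> 0"
    unfolding E2 bernoulli_even_eq_zeta[OF n] by simp
  have "map (\<lambda>i. (1, Some i)) [1..<Suc n] \<in> {ts \<in> expansion n n. involves_all n ts}"
    unfolding involves_all_expansion_eq by (intro imageI permutations_of_setI) auto
  then have nonempty: "{ts \<in> expansion n n. involves_all n ts} \<noteq> {}"
    by blast
  have general: "let K = (\<Sum>i=1..n. k i);
             E = (\<integral>\<theta>. (\<Prod>i=1..n. bernpoly (k i) (\<theta> i)) \<partial>\<mu>H n)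
         in integrable (\<mu>H n) (\<lambda>\<theta>. \<Prod>i=1..n. bernpoly (k i) (\<theta> i)) \<and>
            ((\<lambda>m. \<Prod>i=1..n. bernpoly_fourier (k i) m) has_sum complex_of_real E) (UNIV - {0}) \<and>
            E = (if even K
                 then 2 * (-1) powi (int n - int (K div 2)) * (\<Prod>i=1..n. fact (k i)) *
                        zeta (real K) / (2 * pi) ^ K
                 else 0)" if k: "\<forall>i\<in>{1..n}. k i \<ge> 1" for k
  proof -
    \<comment> \<open>All exponents are at least 1 and n >= 2, so K >= 2; this is the range in which
      the zeta series converges and Euler's formula holds.\<close>
    have "(\<Sum>i=1..n. 1) \<le> (\<Sum>i=1..n. k i)"
      using k by (intro sum_mono) auto
    then have K: "(\<Sum>i=1..n. k i) \<ge> 2"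
      using assms(1) by simp
    have prod: "integrable (\<mu>H n) (\<lambda>\<theta>. \<Prod>i=1..n. bernpoly (k i) (\<theta> i))"
      "(\<integral>\<theta>. (\<Prod>i=1..n. bernpoly (k i) (\<theta> i)) \<partial>\<mu>H n) =
        (-1) ^ (n + 1) * (\<Prod>i=1..n. fact (k i)) / fact (\<Sum>i=1..n. k i) * bernoulli (\<Sum>i=1..n. k i)"
      by (rule \<mu>H_bernpoly_prod[where k = k, OF n]; use k in blast)+
    show ?thesis
      unfolding Let_def prod(2)
      by (intro conjI prod(1) has_sum_bernpoly_fourier_prod[OF K] integral_eq_zeta[OF K])
  qed
  have I2: "integrable (\<mu>H n) (\<lambda>\<theta>. \<Prod>i=1..n. bernpoly 2 (\<theta> i))"
    by (rule \<mu>H_bernpoly_prod(1)[where k = "\<lambda>_. 2", OF n]) simp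
  have small: "\<not> involves_all n ts" if "j < n" "ts \<in> expansion n j" for j ts
    using involves_all_imp_le[OF that(2)] that(1) by auto
  show ?thesis
    by (intro conjI allI ballI impI Q_expansion small sum_c1_power_terms nonempty
        involves_all_expansion_subset sum_involves_all I2 E2 E2_nz bernoulli_even_eq_zeta n
        uniform_cube_bernpoly_2 bernpoly_fourier_integral_frac general) blast+
qed

end
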